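(* Let $K$ be an algebraically closed field of characteristic $0$, and let $\mathcal{G}\subset\mathrm{PGL}_3(K)$ be a finite subgroup with $\#\mathcal{G}\ge 3$. Suppose that there exists a map $f\in\mathrm{Rat}_2^2(\mathcal{G})^{ss}(K)$ such that: (i) $f:\mathbb{P}^2\dashrightarrow\mathbb{P}^2$ is dominant; (ii) $\deg(f)=2$; (iii) $\mathrm{Aut}(f)$ is finite. Then there is a $\mathrm{PGL}_3(K)$-conjugate of $\mathcal{G}$ that contains one of the following groups, where $\zeta_n$ denotes a primitive $n$-th root of unity and $i$ a primitive 4th root of unity: $$\mathcal{G}_3=\langle\mathrm{diag}(1,\zeta_3,\zeta_3^2)\rangle,\quad \mathcal{G}_4=\langle\mathrm{diag}(1,i,-1)\rangle,\quad \mathcal{G}_5=\langle\mathrm{diag}(1,\zeta_5,\zeta_5^3)\rangle,$$ $$\mathcal{G}_7=\langle\mathrm{diag}(1,\zeta_7,\zeta_7^3)\rangle,\quad \mathcal{G}_{2,2}=\langle\mathrm{diag}(1,-1,1),\ \mathrm{diag}(1,1,-1)\rangle.$$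
   Context: $\mathrm{Rat}_2^2=\mathbb{P}^{17}$ is the space of triples $f=[f_0,f_1,f_2]$ of homogeneous quadratic polynomials in $K[X,Y,Z]$, not all zero, up to common scaling; such $f$ defines a rational map $\mathbb{P}^2\dashrightarrow\mathbb{P}^2$. $\deg(f)$ is the degree of this rational map, i.e. the common degree of its coordinate polynomials after removing common factors. $\mathrm{PGL}_3$ acts on $\mathrm{Rat}_2^2$ by $f^\varphi=\varphi^{-1}\circ f\circ\varphi$, and $\mathrm{Aut}(f)=\{\varphi\in\mathrm{PGL}_3(K): f^\varphi=f\}$. For a finite subgroup $\mathcal{G}\subset\mathrm{PGL}_3(K)$, $\mathrm{Rat}_2^2(\mathcal{G})=\{f\in\mathrm{Rat}_2^2:\mathcal{G}\subseteq\mathrm{Aut}(f)\}$, and $N(\mathcal{G})$ is the normalizer of $\mathcal{G}$ in $\mathrm{PGL}_3(K)$. Semistability is in the sense of geometric invariant theory: for an algebraic subgroup $H\subseteq\mathrm{PGL}_3$ with preimage $\tilde H\subseteq\mathrm{SL}_3$, acting on the 18-dimensional space of triples $F$ of quadratic forms by $F\mapsto\varphi^{-1}\circ F\circ\varphi$, the point $f$ with lift $F\neq0$ is $H$-semistable if $0$ is not in the closure of the $\tilde H$-orbit of $F$. $\mathrm{Rat}_2^2(\mathcal{G})^{ss}$ is the set of $f\in\mathrm{Rat}_2^2(\mathcal{G})$ that are $N(\mathcal{G})$-semistable. Matrices are regarded as elements of $\mathrm{PGL}_3(K)$. *)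

theory Defs
  imports
    "HOL-Analysis.Determinants"
    "HOL-Algebra.Generated_Groups"
    "HOL-Algebra.Group_Action"
    "HOL-Computational_Algebra.Polynomial"
    "HOL-Library.Poly_Mapping"
begin

section \<open>The polynomial ring in three variables\<close>

text \<open>
  A monomial is its exponent vector; the ring structure on \<open>'a mpoly3\<close> is the convolution
  product of \<^theory>\<open>HOL-Library.Poly_Mapping\<close>, so that \<open>'a mpoly3\<close> is K[X,Y,Z].
\<close>

type_synonym 'a mpoly3 = "(3 \<Rightarrow>\<^sub>0 nat) \<Rightarrow>\<^sub>0 'a"

definition Const :: "'a::comm_ring_1 \<Rightarrow> 'a mpoly3" where
  "Const c = Poly_Mapping.single 0 c"

definition Var :: "3 \<Rightarrow> 'a::comm_ring_1 mpoly3" where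
  "Var j = Poly_Mapping.single (Poly_Mapping.single j 1) 1"

text \<open>Evaluation at a vector over a K-algebra with structure map \<open>\<iota>\<close>.\<close>

definition eval_along :: "('a::comm_ring_1 \<Rightarrow> 'b::comm_ring_1) \<Rightarrow> 'b ^ 3 \<Rightarrow> 'a mpoly3 \<Rightarrow> 'b" where
  "eval_along \<iota> x p =
     (\<Sum>m\<in>Poly_Mapping.keys p.
        \<iota> (Poly_Mapping.lookup p m) * (\<Prod>j\<in>UNIV. (x $ j) ^ Poly_Mapping.lookup m j))"

abbreviation eval_at :: "'a::comm_ring_1 ^ 3 \<Rightarrow> 'a mpoly3 \<Rightarrow> 'a" where
  "eval_at \<equiv> eval_along id"

abbreviation subst_at :: "'a::comm_ring_1 mpoly3 ^ 3 \<Rightarrow> 'a mpoly3 \<Rightarrow> 'a mpoly3" where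
  "subst_at \<equiv> eval_along Const"

text \<open>As usual, 0 is homogeneous of every degree.\<close>

definition homogeneous :: "nat \<Rightarrow> 'a::comm_ring_1 mpoly3 \<Rightarrow> bool" where
  "homogeneous d p \<longleftrightarrow>
     (\<forall>m\<in>Poly_Mapping.keys p. (\<Sum>j\<in>UNIV. Poly_Mapping.lookup m j) = d)"


section \<open>The group PGL(3,K)\<close>

definition GL3 :: "('a::field ^ 3 ^ 3) monoid" where
  "GL3 = \<lparr>carrier = {A. invertible A}, mult = (**), one = mat 1\<rparr>"

definition scalars3 :: "('a::field ^ 3 ^ 3) set" where
  "scalars3 = {mat c | c. c \<noteq> 0}"

definition PGL3 :: "('a::field ^ 3 ^ 3) set monoid" where
  "PGL3 = GL3 Mod scalars3"

definition pgl_class :: "'a::field ^ 3 ^ 3 \<Rightarrow> ('a ^ 3 ^ 3) set" where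
  "pgl_class A = scalars3 #>\<^bsub>GL3\<^esub> A"

definition diag3 :: "'a::field \<Rightarrow> 'a \<Rightarrow> 'a \<Rightarrow> 'a ^ 3 ^ 3" where
  "diag3 a b c = (\<chi> i j. if i = j then (vector [a, b, c] :: 'a ^ 3) $ i else 0)"


section \<open>Quadratic rational self-maps of the projective plane\<close>

definition quadratic_triples :: "('a::field mpoly3 ^ 3) set" where
  "quadratic_triples = {F. \<forall>i. homogeneous 2 (F $ i)}"

text \<open>Points of the projective spaces are represented as sets of all their lifts.\<close>

definition rat_class :: "'a::field mpoly3 ^ 3 \<Rightarrow> ('a mpoly3 ^ 3) set" where
  "rat_class F = {Const c *s F | c. c \<noteq> 0}"

definition Rat22 :: "('a::field mpoly3 ^ 3) set set" where
  "Rat22 = {rat_class F | F. F \<in> quadratic_triples \<and> F \<noteq> 0}"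

definition P2_class :: "'a::field ^ 3 \<Rightarrow> ('a ^ 3) set" where
  "P2_class v = {c *s v | c. c \<noteq> 0}"

definition P2 :: "('a::field ^ 3) set set" where
  "P2 = {P2_class v | v. v \<noteq> 0}"

text \<open>
  The Zariski closure in the projective plane: the common zeros of all homogeneous polynomials
  that vanish on \<open>S\<close>.
\<close>

definition P2_closure :: "('a::field ^ 3) set set \<Rightarrow> ('a ^ 3) set set" where
  "P2_closure S =
     {x \<in> P2. \<forall>d p. homogeneous d p \<longrightarrow> (\<forall>s\<in>S. \<forall>v\<in>s. eval_at v p = 0) \<longrightarrow>
                    (\<forall>v\<in>x. eval_at v p = 0)}"

definition apply_triple :: "'a::field mpoly3 ^ 3 \<Rightarrow> 'a ^ 3 \<Rightarrow> 'a ^ 3" where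
  "apply_triple F v = (\<chi> i. eval_at v (F $ i))"

text \<open>
  The image of the open set on which the coordinates of a lift do not all vanish. If the coordinates
  have a common factor, the map may be defined on a larger open set, but its image has the same
  closure.
\<close>

definition rat_image :: "('a::field mpoly3 ^ 3) set \<Rightarrow> ('a ^ 3) set set" where
  "rat_image f = {P2_class (apply_triple F v) | F v. F \<in> f \<and> apply_triple F v \<noteq> 0}"

definition dominant :: "('a::field mpoly3 ^ 3) set \<Rightarrow> bool" where
  "dominant f \<longleftrightarrow> P2_closure (rat_image f) = P2"

text \<open>\<open>f\<close> has degree \<open>d\<close> as a rational map: the common factor \<open>g\<close> of its coordinates is removed.\<close>

definition has_rat_degree :: "('a::field mpoly3 ^ 3) set \<Rightarrow> nat \<Rightarrow> bool" where
  "has_rat_degree f d \<longleftrightarrow>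
     (\<exists>F\<in>f. \<exists>g H. F = g *s H \<and> (\<forall>i. homogeneous d (H $ i)) \<and>
        (\<forall>q. (\<forall>i. q dvd H $ i) \<longrightarrow> q dvd 1))"


section \<open>The conjugation action and automorphism groups\<close>

definition conj_triple :: "'a::field ^ 3 ^ 3 \<Rightarrow> 'a mpoly3 ^ 3 \<Rightarrow> 'a mpoly3 ^ 3" where
  "conj_triple A F =
     (\<chi> i j. Const (matrix_inv A $ i $ j)) *v
     (\<chi> i. subst_at (\<chi> k. \<Sum>l\<in>UNIV. Const (A $ k $ l) * Var l) (F $ i))"

definition rat_conj :: "('a::field mpoly3 ^ 3) set \<Rightarrow> ('a ^ 3 ^ 3) set \<Rightarrow> ('a mpoly3 ^ 3) set" where
  "rat_conj f \<phi> = {conj_triple A F | A F. A \<in> \<phi> \<and> F \<in> f}"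

definition rat_Aut :: "('a::field mpoly3 ^ 3) set \<Rightarrow> ('a ^ 3 ^ 3) set set" where
  "rat_Aut f = {\<phi> \<in> carrier PGL3. rat_conj f \<phi> = f}"

definition Rat22_of :: "('a::field ^ 3 ^ 3) set set \<Rightarrow> ('a mpoly3 ^ 3) set set" where
  "Rat22_of G = {f \<in> Rat22. G \<subseteq> rat_Aut f}"


section \<open>Semistability\<close>

text \<open>
  Polynomial functions on the 18-dimensional space of triples of quadratic forms; its linear
  coordinates are the coefficients of the three forms.
\<close>

inductive_set triple_polyfuns :: "('a::field mpoly3 ^ 3 \<Rightarrow> 'a) set" where
  const: "(\<lambda>F. c) \<in> triple_polyfuns"
| coord: "(\<lambda>F. Poly_Mapping.lookup (F $ i) m) \<in> triple_polyfuns"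
| add: "p \<in> triple_polyfuns \<Longrightarrow> q \<in> triple_polyfuns \<Longrightarrow> (\<lambda>F. p F + q F) \<in> triple_polyfuns"
| mult: "p \<in> triple_polyfuns \<Longrightarrow> q \<in> triple_polyfuns \<Longrightarrow> (\<lambda>F. p F * q F) \<in> triple_polyfuns"

definition triple_closure :: "('a::field mpoly3 ^ 3) set \<Rightarrow> ('a mpoly3 ^ 3) set" where
  "triple_closure S =
     {F \<in> quadratic_triples. \<forall>p\<in>triple_polyfuns. (\<forall>E\<in>S. p E = 0) \<longrightarrow> p F = 0}"

definition SL3_preimage :: "('a::field ^ 3 ^ 3) set set \<Rightarrow> ('a ^ 3 ^ 3) set" where
  "SL3_preimage H = {A. det A = 1 \<and> pgl_class A \<in> H}"

definition semistable :: "('a::field ^ 3 ^ 3) set set \<Rightarrow> ('a mpoly3 ^ 3) set \<Rightarrow> bool" where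
  "semistable H f \<longleftrightarrow>
     (\<forall>F\<in>f. 0 \<notin> triple_closure {conj_triple A F | A. A \<in> SL3_preimage H})"

definition Rat22_ss :: "('a::field ^ 3 ^ 3) set set \<Rightarrow> ('a mpoly3 ^ 3) set set" where
  "Rat22_ss G = {f \<in> Rat22_of G. semistable (normalizer PGL3 G) f}"


section \<open>Roots of unity\<close>

definition primitive_root_of_unity :: "nat \<Rightarrow> 'a::field \<Rightarrow> bool" where
  "primitive_root_of_unity n z \<longleftrightarrow> n > 0 \<and> z ^ n = 1 \<and> (\<forall>m. 0 < m \<and> m < n \<longrightarrow> z ^ m \<noteq> 1)"

end

theory Submission
  imports Defs "HOL-Algebra.Multiplicative_Group"
begin

text \<open>
  Let \<open>F\<close> be a lift of \<open>f\<close>, and call a matrix \<open>A\<close> equivariant for \<open>F\<close> when \<open>F(Av) = c A F(v)\<close>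
  with a nonzero constant \<open>c\<close>; the invertible equivariant matrices are those whose class lies in
  \<open>Aut(f)\<close> (\<open>rat_Aut_iff_equivariant\<close>).  The hypotheses on \<open>f\<close> say that the coordinates of \<open>F\<close> are
  quadratic forms, linearly independent (dominance), without a common linear factor (degree two),
  and that each equivariant matrix has finite order modulo scalars (finiteness of \<open>Aut(f)\<close>).
  These conditions, \<open>regular_triple\<close>, are invariant under linear changes of coordinates.

  For a diagonal matrix \<open>D\<close> with entries \<open>d\<^sub>1, d\<^sub>2, d\<^sub>3\<close>, equivariance is a condition on monomials:
  whenever \<open>X\<^sub>j X\<^sub>k\<close> occurs in the \<open>i\<close>-th coordinate, \<open>d\<^sub>j d\<^sub>k = c d\<^sub>i\<close>.  Two consequences are used.

  First, if \<open>D\<close> has entries \<open>a, a, b\<close>, then \<open>a\<^sup>2 = b\<^sup>2\<close> (\<open>equivariant_homology_square\<close>).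
  Otherwise the monomials are separated by their degree in \<open>Z\<close>, and there are three cases:
  all matrices with entries \<open>1, 1, t\<close> are equivariant, or \<open>Z\<close> divides every coordinate, or the first
  two coordinates are multiples of \<open>Z\<^sup>2\<close>; each is excluded for a regular triple.

  Secondly, let \<open>D\<close> have entries \<open>1, x, y\<close> with \<open>x\<^sup>p = y\<^sup>p = 1\<close>, \<open>x \<noteq> 1\<close> and \<open>p \<ge> 7\<close> prime
  (\<open>equivariant_large_prime\<close>).  The characters \<open>\<epsilon>\<^sub>j + \<epsilon>\<^sub>k - \<epsilon>\<^sub>i\<close> of the torus are twelve points of a
  plane lattice, and \<open>D\<close> takes the same value at each one that occurs in \<open>F\<close>.  Hence \<open>p\<close> divides the
  doubled area of each triangle of occurring points.  If all these areas vanish, the points are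
  collinear and a one-parameter torus is equivariant, which is impossible.  As triangles among the
  twelve points have doubled area at most 7, it follows that \<open>p = 7\<close>, and the extremal triangles force
  \<open>y = x\<^sup>5\<close> or \<open>x = y\<^sup>5\<close>.

  Now if every element of \<open>G\<close> has square 1, two of them lift to commuting involutions, and a common
  eigenbasis puts the Klein four-group of diagonal matrices into a conjugate of \<open>G\<close>
  (\<open>klein_four_of_exponent_two\<close>).  Otherwise \<open>G\<close> contains an element \<open>h\<close> with \<open>h\<^sup>2 \<noteq> 1\<close> and \<open>h\<^sup>n = 1\<close>,
  where \<open>n\<close> is 4 or an odd prime.  It is diagonalizable, by the first consequence its eigenvalues are
  distinct, and after scaling they are \<open>1, z\<^sup>j, z\<^sup>k\<close> for a primitive \<open>n\<close>-th root of unity \<open>z\<close>.  By the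
  second consequence \<open>n \<le> 7\<close>.  Scaling, powers and permutations act on the exponents by affine maps
  modulo \<open>n\<close>, and these carry \<open>{0, j, k}\<close> to \<open>{0, 1, 2}\<close> for \<open>n = 3, 4\<close> and to \<open>{0, 1, 3}\<close>
  for \<open>n = 5, 7\<close> (\<open>diag_in_of_element\<close>).
\<close>

section \<open>Evaluation of polynomials in three variables\<close>

lemma eval_at_superset:
  assumes "finite S" "Poly_Mapping.keys p \<subseteq> S"
  shows "eval_at v p = (\<Sum>m\<in>S. Poly_Mapping.lookup p m * (\<Prod>j\<in>UNIV. (v $ j) ^ Poly_Mapping.lookup m j))"
  unfolding eval_along_def id_apply
  by (rule sum.mono_neutral_left) (use assms in \<open>auto simp: in_keys_iff\<close>)

lemma eval_at_zero [simp]: "eval_at v 0 = 0"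
  by (simp add: eval_along_def)

lemma eval_at_add: "eval_at v (p + q) = eval_at v p + eval_at v q"
proof -
  let ?S = "Poly_Mapping.keys p \<union> Poly_Mapping.keys q"
  have "Poly_Mapping.keys (p + q) \<subseteq> ?S" by (rule keys_add)
  then show ?thesis
    using eval_at_superset[of ?S "p + q" v] eval_at_superset[of ?S p v]
      eval_at_superset[of ?S q v]
    by (simp add: lookup_add algebra_simps sum.distrib)
qed

text \<open>The inductions below present \<open>eval_at\<close> with an eta-expanded identity; \<open>id_apply\<close> would turn it into
  an abstraction to which the evaluation lemmas no longer apply, and is therefore removed.\<close>

lemma eval_at_sum: "eval_at v (\<Sum>a\<in>A. g a) = (\<Sum>a\<in>A. eval_at v (g a))"
  by (induction A rule: infinite_finite_induct) (simp_all add: eval_at_add del: id_apply)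

lemma eval_at_single:
  "eval_at v (Poly_Mapping.single m c) = c * (\<Prod>j\<in>UNIV. (v $ j) ^ Poly_Mapping.lookup m j)"
  using eval_at_superset[of "{m}" "Poly_Mapping.single m c" v] by simp

lemma mpoly3_sum_of_monomials:
  "p = (\<Sum>m\<in>Poly_Mapping.keys p. Poly_Mapping.single m (Poly_Mapping.lookup p m))"
proof (rule poly_mapping_eqI)
  fix k
  have "(\<Sum>m\<in>Poly_Mapping.keys p. Poly_Mapping.lookup (Poly_Mapping.single m (Poly_Mapping.lookup p m)) k)
     = (\<Sum>m\<in>Poly_Mapping.keys p. if k = m then Poly_Mapping.lookup p m else 0)"
    by (rule sum.cong) (auto simp: lookup_single when_def)
  also have "\<dots> = Poly_Mapping.lookup p k"
    by (simp add: in_keys_iff)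
  finally show "Poly_Mapping.lookup p k = Poly_Mapping.lookup
      (\<Sum>m\<in>Poly_Mapping.keys p. Poly_Mapping.single m (Poly_Mapping.lookup p m)) k"
    by (simp add: lookup_sum)
qed

lemma eval_at_mult: "eval_at v (p * q) = eval_at v p * eval_at v q"
proof -
  let ?s = "\<lambda>p m. Poly_Mapping.single m (Poly_Mapping.lookup p m)"
  have mono: "eval_at v (Poly_Mapping.single m c * Poly_Mapping.single n d)
     = eval_at v (Poly_Mapping.single m c) * eval_at v (Poly_Mapping.single n d)" for m n c d
    by (simp add: mult_single eval_at_single lookup_add power_add prod.distrib algebra_simps)
  have "p * q = (\<Sum>m\<in>Poly_Mapping.keys p. \<Sum>n\<in>Poly_Mapping.keys q. ?s p m * ?s q n)"
    by (simp only: sum_product[symmetric] mpoly3_sum_of_monomials[symmetric])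
  then have "eval_at v (p * q)
     = (\<Sum>m\<in>Poly_Mapping.keys p. \<Sum>n\<in>Poly_Mapping.keys q. eval_at v (?s p m) * eval_at v (?s q n))"
    by (simp add: eval_at_sum mono)
  also have "\<dots> = eval_at v (\<Sum>m\<in>Poly_Mapping.keys p. ?s p m) * eval_at v (\<Sum>n\<in>Poly_Mapping.keys q. ?s q n)"
    by (simp add: eval_at_sum sum_product)
  finally show ?thesis
    by (simp only: mpoly3_sum_of_monomials[symmetric])
qed

lemma eval_at_Const [simp]: "eval_at v (Const c) = c"
  by (simp add: Const_def eval_at_single)

lemma eval_at_one [simp]: "eval_at v 1 = 1"
  using eval_at_Const[of v 1] by (simp add: Const_def)

lemma eval_at_Var [simp]: "eval_at v (Var j) = v $ j"
proof -
  have "(\<Prod>k\<in>UNIV. (v $ k) ^ Poly_Mapping.lookup (Poly_Mapping.single j (1::nat)) k)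
      = (\<Prod>k\<in>UNIV. if k = j then v $ j else 1)"
    by (rule prod.cong) (auto simp: lookup_single when_def)
  then show ?thesis by (simp add: Var_def eval_at_single)
qed

lemma eval_at_power: "eval_at v (p ^ n) = eval_at v p ^ n"
  by (induction n) (simp_all add: eval_at_mult del: id_apply)

lemma eval_at_prod: "eval_at v (\<Prod>a\<in>A. g a) = (\<Prod>a\<in>A. eval_at v (g a))"
  by (induction A rule: infinite_finite_induct) (simp_all add: eval_at_mult del: id_apply)

lemma eval_at_subst_at: "eval_at v (subst_at y p) = eval_at (\<chi> k. eval_at v (y $ k)) p"
  by (simp add: eval_along_def[of Const] eval_at_sum eval_at_mult eval_at_prod eval_at_power)
     (simp add: eval_along_def)

lemma matrix_vector_mult_component: "(A *v x) $ i = (\<Sum>j\<in>UNIV. A $ i $ j * x $ j)"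
  by (simp add: matrix_vector_mult_def)

lemma apply_conj_triple:
  "apply_triple (conj_triple A F) v = matrix_inv A *v apply_triple F (A *v v)"
  by (simp add: vec_eq_iff apply_triple_def conj_triple_def matrix_vector_mult_component
      eval_at_sum eval_at_mult eval_at_subst_at)
    (simp add: matrix_vector_mult_def)

lemma apply_smult_triple: "apply_triple (Const c *s F) v = c *s apply_triple F v"
  by (simp add: vec_eq_iff apply_triple_def eval_at_mult)

section \<open>Homogeneous polynomials\<close>

lemma homogeneous_zero [simp]: "homogeneous d 0"
  by (simp add: homogeneous_def)

lemma homogeneous_add: "homogeneous d p \<Longrightarrow> homogeneous d q \<Longrightarrow> homogeneous d (p + q)"
  using keys_add[of p q] unfolding homogeneous_def by blast

lemma homogeneous_sum: "(\<And>a. a \<in> A \<Longrightarrow> homogeneous d (g a)) \<Longrightarrow> homogeneous d (\<Sum>a\<in>A. g a)"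
  by (induction A rule: infinite_finite_induct) (auto intro: homogeneous_add)

lemma homogeneous_mult:
  assumes "homogeneous d p" "homogeneous e q" shows "homogeneous (d + e) (p * q)"
  unfolding homogeneous_def
proof
  fix m assume "m \<in> Poly_Mapping.keys (p * q)"
  then obtain k l where "m = k + l" "k \<in> Poly_Mapping.keys p" "l \<in> Poly_Mapping.keys q"
    using keys_mult[of p q] by blast
  then show "(\<Sum>j\<in>UNIV. Poly_Mapping.lookup m j) = d + e"
    using assms unfolding homogeneous_def by (simp add: lookup_add sum.distrib)
qed

lemma homogeneous_Const: "homogeneous 0 (Const c)"
  by (simp add: homogeneous_def Const_def)

lemma homogeneous_one [simp]: "homogeneous 0 1"
  by (simp add: homogeneous_def)

lemma homogeneous_Var: "homogeneous (Suc 0) (Var j)"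
proof -
  have "(\<Sum>k\<in>UNIV. Poly_Mapping.lookup (Poly_Mapping.single j (1::nat)) k)
      = (\<Sum>k\<in>UNIV. if k = j then 1 else 0)"
    by (rule sum.cong) (auto simp: lookup_single when_def)
  then show ?thesis by (simp add: homogeneous_def Var_def)
qed

lemma homogeneous_Const_mult: "homogeneous d p \<Longrightarrow> homogeneous d (Const c * p)"
  using homogeneous_mult[OF homogeneous_Const] by fastforce

lemma homogeneous_power: "homogeneous d p \<Longrightarrow> homogeneous (n * d) (p ^ n)"
  by (induction n) (auto dest: homogeneous_mult)

lemma homogeneous_prod:
  "(\<And>a. a \<in> A \<Longrightarrow> homogeneous (d a) (g a)) \<Longrightarrow> homogeneous (\<Sum>a\<in>A. d a) (\<Prod>a\<in>A. g a)"
  by (induction A rule: infinite_finite_induct) (auto intro: homogeneous_mult)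

lemma homogeneous_subst_at:
  assumes "homogeneous d p" "\<And>k. homogeneous 1 (y $ k)"
  shows "homogeneous d (subst_at y p)"
  unfolding eval_along_def
proof (rule homogeneous_sum, rule homogeneous_Const_mult)
  fix m assume "m \<in> Poly_Mapping.keys p"
  then have "d = (\<Sum>j\<in>UNIV. Poly_Mapping.lookup m j * 1)"
    using assms(1) by (simp add: homogeneous_def)
  moreover have "homogeneous (\<Sum>j\<in>UNIV. Poly_Mapping.lookup m j * 1)
      (\<Prod>j\<in>UNIV. (y $ j) ^ Poly_Mapping.lookup m j)"
    by (intro homogeneous_prod homogeneous_power assms)
  ultimately show "homogeneous d (\<Prod>j\<in>UNIV. (y $ j) ^ Poly_Mapping.lookup m j)" by simp
qed

lemma conj_triple_quadratic:
  assumes "F \<in> quadratic_triples" shows "conj_triple A F \<in> quadratic_triples"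
  using assms unfolding quadratic_triples_def conj_triple_def
  by (auto simp: matrix_vector_mult_component
      intro!: homogeneous_sum homogeneous_Const_mult homogeneous_subst_at homogeneous_Var)

section \<open>Quadratic forms\<close>

text \<open>The exponent vector of the monomial \<open>X\<^sup>a Y\<^sup>b Z\<^sup>c\<close>; in the index type \<open>3\<close> the numeral \<open>3\<close> denotes 0.\<close>

definition mono3 :: "nat \<Rightarrow> nat \<Rightarrow> nat \<Rightarrow> (3 \<Rightarrow>\<^sub>0 nat)" where
  "mono3 a b c = Poly_Mapping.single 1 a + Poly_Mapping.single 2 b + Poly_Mapping.single 3 c"

lemma lookup_mono3 [simp]:
  "Poly_Mapping.lookup (mono3 a b c) 1 = a"
  "Poly_Mapping.lookup (mono3 a b c) 2 = b"
  "Poly_Mapping.lookup (mono3 a b c) 3 = c"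
  by (auto simp: mono3_def lookup_add lookup_single)

lemma mono3_eq_iff: "mono3 a b c = mono3 a' b' c' \<longleftrightarrow> a = a' \<and> b = b' \<and> c = c'"
  by (metis lookup_mono3)

lemma mono3_lookup:
  "m = mono3 (Poly_Mapping.lookup m 1) (Poly_Mapping.lookup m 2) (Poly_Mapping.lookup m 3)"
proof (rule poly_mapping_eqI)
  fix k :: 3
  show "Poly_Mapping.lookup m k = Poly_Mapping.lookup
    (mono3 (Poly_Mapping.lookup m 1) (Poly_Mapping.lookup m 2) (Poly_Mapping.lookup m 3)) k"
    using exhaust_3[of k] by auto
qed

lemma degree_two_monomials:
  assumes "homogeneous 2 p"
  shows "Poly_Mapping.keys p \<subseteq>
    {mono3 2 0 0, mono3 0 2 0, mono3 0 0 2, mono3 1 1 0, mono3 1 0 1, mono3 0 1 1}"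
proof
  fix m assume "m \<in> Poly_Mapping.keys p"
  then have s: "Poly_Mapping.lookup m 1 + Poly_Mapping.lookup m 2 + Poly_Mapping.lookup m 3 = 2"
    using assms by (simp add: homogeneous_def sum_3)
  have "(a = 2 \<and> b = 0 \<and> c = 0) \<or> (a = 0 \<and> b = 2 \<and> c = 0) \<or> (a = 0 \<and> b = 0 \<and> c = 2)
     \<or> (a = 1 \<and> b = 1 \<and> c = 0) \<or> (a = 1 \<and> b = 0 \<and> c = 1) \<or> (a = 0 \<and> b = 1 \<and> c = 1)"
    if "a + b + c = (2::nat)" for a b c
    using that by presburger
  from this[OF s] show "m \<in> {mono3 2 0 0, mono3 0 2 0, mono3 0 0 2, mono3 1 1 0, mono3 1 0 1, mono3 0 1 1}"
    using mono3_lookup[of m] by (elim disjE conjE) (simp_all only: insert_iff, simp_all)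
qed

lemma eval_at_quadratic:
  assumes "homogeneous 2 p"
  shows "eval_at v p =
      Poly_Mapping.lookup p (mono3 2 0 0) * (v $ 1)\<^sup>2 + Poly_Mapping.lookup p (mono3 0 2 0) * (v $ 2)\<^sup>2
    + Poly_Mapping.lookup p (mono3 0 0 2) * (v $ 3)\<^sup>2 + Poly_Mapping.lookup p (mono3 1 1 0) * (v $ 1 * v $ 2)
    + Poly_Mapping.lookup p (mono3 1 0 1) * (v $ 1 * v $ 3) + Poly_Mapping.lookup p (mono3 0 1 1) * (v $ 2 * v $ 3)"
proof -
  have "(\<Prod>j\<in>UNIV. g j) = g 1 * g 2 * g 3" for g :: "3 \<Rightarrow> 'a"
    unfolding UNIV_3 by (simp add: mult.assoc)
  then show ?thesis
    by (simp add: eval_at_superset[OF _ degree_two_monomials[OF assms]] mono3_eq_iff algebra_simps)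
qed

lemma quadratic_form_coeffs:
  fixes a b c d e f :: "'a::comm_ring_1"
  assumes "\<And>x y z :: 'a. a*x\<^sup>2 + b*y\<^sup>2 + c*z\<^sup>2 + d*(x*y) + e*(x*z) + f*(y*z)
     = a'*x\<^sup>2 + b'*y\<^sup>2 + c'*z\<^sup>2 + d'*(x*y) + e'*(x*z) + f'*(y*z)"
  shows "a = a' \<and> b = b' \<and> c = c' \<and> d = d' \<and> e = e' \<and> f = f'"
proof -
  have "a = a'" "b = b'" "c = c'"
    using assms[of 1 0 0] assms[of 0 1 0] assms[of 0 0 1] by auto
  then show ?thesis
    using assms[of 1 1 0] assms[of 1 0 1] assms[of 0 1 1] by auto
qed

text \<open>Over any commutative ring, a quadratic form is determined by its values.\<close>

lemma quadratic_eqI: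
  assumes "homogeneous 2 p" "homogeneous 2 q" "\<And>v. eval_at v p = eval_at v q"
  shows "p = q"
proof -
  let ?S = "{mono3 2 0 0, mono3 0 2 0, mono3 0 0 2, mono3 1 1 0, mono3 1 0 1, mono3 0 1 1}"
  have "Poly_Mapping.lookup p m = Poly_Mapping.lookup q m" if "m \<in> ?S" for m
  proof -
    have "eval_at (vector [x, y, z]) p = eval_at (vector [x, y, z]) q" for x y z
      by (rule assms(3))
    from this[unfolded eval_at_quadratic[OF assms(1)] eval_at_quadratic[OF assms(2)] vector_3,
        THEN quadratic_form_coeffs]
    show ?thesis using that by (elim insertE emptyE) simp_all
  qed
  note on_S = this
  show ?thesis
  proof (rule poly_mapping_eqI)
    fix m
    show "Poly_Mapping.lookup p m = Poly_Mapping.lookup q m"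
    proof (cases "m \<in> ?S")
      case False
      then have "m \<notin> Poly_Mapping.keys p" "m \<notin> Poly_Mapping.keys q"
        using degree_two_monomials[OF assms(1)] degree_two_monomials[OF assms(2)] by blast+
      then show ?thesis by (simp add: in_keys_iff)
    qed (rule on_S)
  qed
qed

section \<open>Invertible matrices and their classes in PGL(3,K)\<close>

lemma matrix_inv_inverse:
  fixes A :: "'a::field^'n^'n"
  assumes "invertible A"
  shows "A ** matrix_inv A = mat 1" "matrix_inv A ** A = mat 1"
proof -
  have "A ** matrix_inv A = mat 1 \<and> matrix_inv A ** A = mat 1"
    using assms unfolding invertible_def matrix_inv_def by (rule someI_ex)
  then show "A ** matrix_inv A = mat 1" "matrix_inv A ** A = mat 1" by auto
qed

lemma invertible_matrix_inv:
  fixes A :: "'a::field^'n^'n"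
  shows "invertible A \<Longrightarrow> invertible (matrix_inv A)"
  using matrix_inv_inverse invertible_def by blast

lemma matrix_inv_cancel:
  fixes P :: "'a::field^'n^'n"
  assumes "invertible P"
  shows "P ** (matrix_inv P ** A) = A" "matrix_inv P ** (P ** A) = A"
    "P *v (matrix_inv P *v v) = v" "matrix_inv P *v (P *v v) = v"
  by (simp_all add: matrix_mul_assoc matrix_vector_mul_assoc matrix_inv_inverse[OF assms])

lemma invertible_mat: "c \<noteq> 0 \<Longrightarrow> invertible (mat c :: 'a::field^'n^'n)"
  unfolding invertible_right_inverse
  by (rule exI[of _ "mat (inverse c)"])
     (simp add: vec_eq_iff matrix_matrix_mult_def mat_def if_distrib[of "\<lambda>x. x * _"]
       if_distrib[of "\<lambda>x. _ * x"] cong: if_cong)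

lemma mat_mult_eq: "mat c ** A = (\<chi> i j. c * A $ i $ j)"
  by (simp add: vec_eq_iff matrix_matrix_mult_def mat_def if_distrib[of "\<lambda>x. x * _"] cong: if_cong)

lemma mult_mat_eq: "A ** mat c = mat c ** (A :: 'a::comm_semiring_1^'n^'n)"
  by (simp add: vec_eq_iff mat_mult_eq)
     (simp add: matrix_matrix_mult_def mat_def if_distrib[of "\<lambda>x. _ * x"] mult.commute cong: if_cong)

lemma mat_mult_mat: "mat c ** mat d = (mat (c * d) :: 'a::comm_semiring_1^'n^'n)"
  by (simp add: vec_eq_iff mat_mult_eq) (simp add: mat_def)

lemma mat_vector_mult: "mat c *v v = c *s (v :: 'a::comm_semiring_1^'n)"
  by (simp add: vec_eq_iff matrix_vector_mult_def mat_def if_distrib[of "\<lambda>x. x * _"] cong: if_cong)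

lemma GL3_simps [simp]:
  "carrier GL3 = {A. invertible A}" "monoid.mult GL3 = (**)" "one GL3 = mat 1"
  by (simp_all add: GL3_def)

lemma group_GL3: "group (GL3 :: ('a::field^3^3) monoid)"
proof (rule groupI)
  fix A :: "'a^3^3" assume "A \<in> carrier GL3"
  then show "\<exists>B\<in>carrier GL3. B \<otimes>\<^bsub>GL3\<^esub> A = \<one>\<^bsub>GL3\<^esub>"
    using matrix_inv_inverse invertible_matrix_inv by auto
qed (auto simp: invertible_mult matrix_mul_assoc invertible_mat)

lemma pgl_class_eq: "pgl_class A = {mat c ** A | c. c \<noteq> 0}"
  by (auto simp: pgl_class_def r_coset_def scalars3_def)

lemma scalars3_normal: "scalars3 \<lhd> (GL3 :: ('a::field^3^3) monoid)"
proof (rule group.normalI[OF group_GL3])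
  show "subgroup scalars3 (GL3 :: ('a^3^3) monoid)"
  proof (rule group.subgroupI[OF group_GL3])
    show "scalars3 \<subseteq> carrier (GL3 :: ('a^3^3) monoid)" "scalars3 \<noteq> ({} :: ('a^3^3) set)"
      by (auto simp: scalars3_def invertible_mat intro: exI[of _ 1])
  next
    fix A :: "'a^3^3" assume "A \<in> scalars3"
    then obtain c where c: "A = mat c" "c \<noteq> 0" by (auto simp: scalars3_def)
    then have "inv\<^bsub>GL3\<^esub> A = mat (inverse c)"
      by (intro group.inv_equality[OF group_GL3]) (auto simp: mat_mult_mat invertible_mat)
    then show "inv\<^bsub>GL3\<^esub> A \<in> scalars3" using c by (auto simp: scalars3_def)
  next
    fix A B :: "'a^3^3" assume "A \<in> scalars3" "B \<in> scalars3"
    then show "A \<otimes>\<^bsub>GL3\<^esub> B \<in> scalars3"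
      by (force simp: scalars3_def mat_mult_mat)
  qed
  show "\<forall>A\<in>carrier GL3. scalars3 #>\<^bsub>GL3\<^esub> A = A <#\<^bsub>GL3\<^esub> (scalars3 :: ('a^3^3) set)"
    by (auto simp: r_coset_def l_coset_def scalars3_def mult_mat_eq)
qed

lemma group_PGL3: "group PGL3"
  unfolding PGL3_def by (rule normal.factorgroup_is_group[OF scalars3_normal])

lemma carrier_PGL3: "carrier PGL3 = {pgl_class A | A. invertible A}"
  by (auto simp: PGL3_def carrier_FactGroup pgl_class_def)

lemma pgl_class_in_carrier: "invertible A \<Longrightarrow> pgl_class A \<in> carrier PGL3"
  by (auto simp: carrier_PGL3)

lemma pgl_class_mult:
  "invertible A \<Longrightarrow> invertible B \<Longrightarrow>
    pgl_class A \<otimes>\<^bsub>PGL3\<^esub> pgl_class B = pgl_class (A ** B)"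
  using normal.rcos_sum[OF scalars3_normal, of A B] by (simp add: PGL3_def pgl_class_def)

lemma pgl_class_one: "\<one>\<^bsub>PGL3\<^esub> = pgl_class (mat 1)"
  by (auto simp: PGL3_def pgl_class_eq scalars3_def)

lemma pgl_class_scale:
  assumes "c \<noteq> 0" shows "pgl_class (mat c ** A) = pgl_class A"
proof -
  have "\<exists>d. mat b ** A = mat d ** (mat c ** A) \<and> d \<noteq> 0" if "b \<noteq> 0" for b
    using that assms by (intro exI[of _ "b / c"]) (simp add: matrix_mul_assoc mat_mult_mat)
  then show ?thesis
    using assms by (auto simp: pgl_class_eq matrix_mul_assoc mat_mult_mat)
qed

lemma pgl_class_refl: "A \<in> pgl_class A"
  unfolding pgl_class_eq by (rule CollectI, rule exI[of _ 1]) simp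

lemma pgl_class_eqD:
  assumes "pgl_class A = pgl_class B" obtains c where "c \<noteq> 0" "A = mat c ** B"
proof -
  have "A \<in> pgl_class B" using assms pgl_class_refl by metis
  then show ?thesis using that by (auto simp: pgl_class_eq)
qed

lemma pgl_class_inv:
  "invertible A \<Longrightarrow> inv\<^bsub>PGL3\<^esub> (pgl_class A) = pgl_class (matrix_inv A)"
  by (rule group.inv_equality[OF group_PGL3])
     (auto simp: pgl_class_mult invertible_matrix_inv pgl_class_in_carrier matrix_inv_inverse pgl_class_one)

text \<open>The product of matrices is \<open>(**)\<close>, whereas \<open>(^)\<close> on vectors of vectors
  is the componentwise power; hence the separate notation.\<close>

primrec mpow :: "'a::semiring_1^'n^'n \<Rightarrow> nat \<Rightarrow> 'a^'n^'n" where
  "mpow A 0 = mat 1"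
| "mpow A (Suc n) = A ** mpow A n"

lemma mpow_add: "mpow A (m + n) = mpow A m ** mpow A n"
  by (induction m) (auto simp: matrix_mul_assoc)

lemma mpow_invertible: "invertible A \<Longrightarrow> invertible (mpow (A :: 'a::field^'n^'n) n)"
  by (induction n) (auto simp: invertible_mult invertible_mat)

lemma mpow_conj:
  assumes "A ** P = P ** B" shows "mpow A n ** P = P ** mpow B n"
proof (induction n)
  case (Suc n)
  have "mpow A (Suc n) ** P = A ** (P ** mpow B n)"
    by (simp add: Suc matrix_mul_assoc[symmetric])
  then show ?case by (simp add: assms matrix_mul_assoc)
qed simp

lemma mpow_scale: "mpow (mat c ** A) n = mat (c ^ n) ** mpow (A :: 'a::comm_semiring_1^'n^'n) n"
proof (induction n)
  case (Suc n)
  have "mpow (mat c ** A) (Suc n) = mat c ** (A ** mat (c ^ n)) ** mpow A n"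
    by (simp add: Suc matrix_mul_assoc)
  also have "\<dots> = (mat c ** mat (c ^ n)) ** (A ** mpow A n)"
    unfolding mult_mat_eq[of A] by (simp add: matrix_mul_assoc)
  finally show ?case by (simp add: mat_mult_mat)
qed simp

lemma pgl_class_pow:
  assumes "invertible A" shows "pgl_class A [^]\<^bsub>PGL3\<^esub> n = pgl_class (mpow A n)"
proof (induction n)
  case 0 then show ?case
    by (simp add: group.is_monoid[OF group_PGL3] monoid.nat_pow_0 pgl_class_one)
next
  case (Suc n)
  have "pgl_class A [^]\<^bsub>PGL3\<^esub> Suc n = pgl_class A \<otimes>\<^bsub>PGL3\<^esub> (pgl_class A [^]\<^bsub>PGL3\<^esub> n)"
    by (rule monoid.nat_pow_Suc2[OF group.is_monoid[OF group_PGL3] pgl_class_in_carrier[OF assms]])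
  then show ?case by (simp add: Suc pgl_class_mult assms mpow_invertible)
qed

section \<open>Equivariance and automorphisms\<close>

text \<open>The matrix \<open>A\<close> commutes with the map of \<open>F\<close> up to a constant.  This avoids the inverse in
  \<open>conj_triple\<close>, and works on values instead of polynomials.\<close>

definition equivariant :: "'a::field mpoly3 ^ 3 \<Rightarrow> 'a ^ 3 ^ 3 \<Rightarrow> bool" where
  "equivariant F A \<longleftrightarrow>
     (\<exists>c. c \<noteq> 0 \<and> (\<forall>v. apply_triple F (A *v v) = c *s (A *v apply_triple F v)))"

lemma equivariant_mult:
  assumes "equivariant F A" "equivariant F B" shows "equivariant F (A ** B)"
proof -
  obtain a b where ab: "a \<noteq> 0" "b \<noteq> 0"
      "\<And>v. apply_triple F (A *v v) = a *s (A *v apply_triple F v)"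
      "\<And>v. apply_triple F (B *v v) = b *s (B *v apply_triple F v)"
    using assms unfolding equivariant_def by blast
  then have "apply_triple F ((A ** B) *v v) = (a * b) *s ((A ** B) *v apply_triple F v)" for v
    by (simp add: matrix_vector_mul_assoc[symmetric] vector_scalar_commute)
  then show ?thesis using ab unfolding equivariant_def by (intro exI[of _ "a * b"]) simp
qed

lemma equivariant_mpow: "equivariant F A \<Longrightarrow> equivariant F (mpow A n)"
proof (induction n)
  case 0 show ?case by (auto simp: equivariant_def intro!: exI[of _ 1])
qed (simp add: equivariant_mult)

lemma quadratic_triple_eqI:
  assumes "F \<in> quadratic_triples" "E \<in> quadratic_triples"
    "\<And>v. apply_triple F v = apply_triple E v"
  shows "F = E"
  unfolding vec_eq_iff
proof
  fix i show "F $ i = E $ i"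
    by (rule quadratic_eqI)
       (use assms in \<open>auto simp: quadratic_triples_def apply_triple_def vec_eq_iff\<close>)
qed

lemma apply_triple_scale:
  assumes "F \<in> quadratic_triples"
  shows "apply_triple F (c *s v) = c\<^sup>2 *s apply_triple F v"
proof -
  have "homogeneous 2 (F $ i)" for i using assms by (simp add: quadratic_triples_def)
  then show ?thesis
    by (simp add: vec_eq_iff apply_triple_def eval_at_quadratic algebra_simps power2_eq_square)
qed

lemma smult_triple_quadratic: "F \<in> quadratic_triples \<Longrightarrow> Const c *s F \<in> quadratic_triples"
  by (simp add: quadratic_triples_def homogeneous_Const_mult)

lemma conj_triple_eqI:
  assumes "invertible A" "F \<in> quadratic_triples" "E \<in> quadratic_triples"
    "\<And>v. apply_triple F (A *v v) = A *v apply_triple E v"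
  shows "conj_triple A F = E"
  by (rule quadratic_triple_eqI)
     (use assms in \<open>simp_all add: conj_triple_quadratic apply_conj_triple matrix_inv_cancel\<close>)

lemma rat_class_refl: "F \<in> rat_class F"
  unfolding rat_class_def by (rule CollectI, rule exI[of _ 1]) (simp add: Const_def)

lemma rat_Aut_iff_equivariant:
  assumes F: "F \<in> quadratic_triples" and A: "invertible A"
  shows "pgl_class A \<in> rat_Aut (rat_class F) \<longleftrightarrow> equivariant F A"
proof
  assume "pgl_class A \<in> rat_Aut (rat_class F)"
  then have eq: "rat_conj (rat_class F) (pgl_class A) = rat_class F" by (simp add: rat_Aut_def)
  have "conj_triple A F \<in> rat_conj (rat_class F) (pgl_class A)"
    unfolding rat_conj_def using rat_class_refl pgl_class_refl by blast
  then have "conj_triple A F \<in> rat_class F" by (simp only: eq)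
  then obtain c where c: "c \<noteq> 0" "conj_triple A F = Const c *s F"
    by (auto simp: rat_class_def)
  have "apply_triple F (A *v v) = c *s (A *v apply_triple F v)" for v
  proof -
    have "matrix_inv A *v apply_triple F (A *v v) = c *s apply_triple F v"
      by (metis apply_conj_triple apply_smult_triple c(2))
    then have "A *v (matrix_inv A *v apply_triple F (A *v v)) = A *v (c *s apply_triple F v)" by simp
    then show ?thesis by (simp add: matrix_inv_cancel[OF A] vector_scalar_commute)
  qed
  then show "equivariant F A" using c(1) unfolding equivariant_def by blast
next
  assume "equivariant F A"
  then obtain c where c: "c \<noteq> 0" "\<And>v. apply_triple F (A *v v) = c *s (A *v apply_triple F v)"
    unfolding equivariant_def by blast
  have conj: "conj_triple (mat s ** A) (Const d *s F) = Const (s * d * c) *s F" if "s \<noteq> 0" for s d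
  proof (rule conj_triple_eqI)
    show "invertible (mat s ** A)" using that A by (simp add: invertible_mult invertible_mat)
    fix v
    show "apply_triple (Const d *s F) ((mat s ** A) *v v)
        = (mat s ** A) *v apply_triple (Const (s * d * c) *s F) v"
      by (simp add: matrix_vector_mul_assoc[symmetric] mat_vector_mult apply_smult_triple
          apply_triple_scale[OF F] c(2) vector_scalar_commute)
        (simp add: vector_smult_assoc power2_eq_square mult.commute mult.left_commute)
  qed (use F in \<open>simp_all add: smult_triple_quadratic\<close>)
  have "rat_conj (rat_class F) (pgl_class A) = rat_class F"
  proof
    show "rat_conj (rat_class F) (pgl_class A) \<subseteq> rat_class F"
      using c(1) conj by (auto simp: rat_conj_def rat_class_def pgl_class_eq)
    show "rat_class F \<subseteq> rat_conj (rat_class F) (pgl_class A)"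
    proof
      fix E assume "E \<in> rat_class F"
      then obtain d where d: "d \<noteq> 0" "E = Const d *s F" by (auto simp: rat_class_def)
      then have "E = conj_triple (mat 1 ** A) (Const (d / c) *s F)"
        using conj[of 1 "d / c"] c(1) by simp
      moreover have "mat 1 ** A \<in> pgl_class A" by (simp add: pgl_class_refl)
      moreover have "Const (d / c) *s F \<in> rat_class F"
        using c(1) d(1) by (auto simp: rat_class_def)
      ultimately show "E \<in> rat_conj (rat_class F) (pgl_class A)"
        unfolding rat_conj_def by blast
    qed
  qed
  then show "pgl_class A \<in> rat_Aut (rat_class F)"
    using A by (simp add: rat_Aut_def pgl_class_in_carrier)
qed

section \<open>Regular triples\<close>

text \<open>The properties of a lift of \<open>f\<close> on which the classification rests: quadratic coordinates that are
  linearly independent and have no common linear factor, and only equivariant matrices of finite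
  order modulo scalars.  A common linear factor is expressed through values, with \<open>l\<close> the
  coefficients of the factor and the rows of \<open>L\<close> those of the cofactors; \<open>L = 0\<close> is included.\<close>

definition regular_triple :: "'a::field mpoly3 ^ 3 \<Rightarrow> bool" where
  "regular_triple F \<longleftrightarrow> F \<in> quadratic_triples
    \<and> (\<forall>l. (\<forall>v. (\<Sum>i\<in>UNIV. l $ i * apply_triple F v $ i) = 0) \<longrightarrow> l = 0)
    \<and> (\<nexists>l L. \<forall>v. apply_triple F v = (\<Sum>i\<in>UNIV. l $ i * v $ i) *s (L *v v))
    \<and> (\<forall>A. invertible A \<longrightarrow> equivariant F A \<longrightarrow> (\<exists>n>0. \<exists>c. mpow A n = mat c))"

lemma sum_mult_matrix_vector:
  "(\<Sum>i\<in>UNIV. l $ i * (A *v v) $ i) = (\<Sum>i\<in>UNIV. (l v* A) $ i * (v $ i :: 'a::comm_semiring_1))"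
proof -
  have "(\<Sum>i\<in>UNIV. l $ i * (A *v v) $ i) = (\<Sum>i\<in>UNIV. \<Sum>j\<in>UNIV. l $ i * (A $ i $ j * v $ j))"
    by (simp add: matrix_vector_mult_def sum_distrib_left)
  also have "\<dots> = (\<Sum>j\<in>UNIV. \<Sum>i\<in>UNIV. l $ i * (A $ i $ j * v $ j))" by (rule sum.swap)
  finally show ?thesis by (simp add: vector_matrix_mult_def sum_distrib_left sum_distrib_right ac_simps)
qed

text \<open>Conjugating the triple by \<open>P\<close> conjugates its equivariant matrices by \<open>P\<close>; the relation
  \<open>A = P D P\<^sup>-\<^sup>1\<close> is written without inverses.\<close>

lemma equivariant_conj_triple:
  assumes P: "invertible P" and AD: "A ** P = P ** D"
  shows "equivariant (conj_triple P F) D \<longleftrightarrow> equivariant F A"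
proof -
  let ?E = "apply_triple (conj_triple P F)" and ?Q = "matrix_inv P"
  have F: "apply_triple F v = P *v ?E (?Q *v v)" for v
    by (simp add: apply_conj_triple matrix_inv_cancel P)
  have AP: "A *v (P *v v) = P *v (D *v v)" for v
    by (simp add: matrix_vector_mul_assoc AD)
  have pointwise: "?E (D *v v) = c *s (D *v ?E v) \<longleftrightarrow>
      apply_triple F (A *v (P *v v)) = c *s (A *v apply_triple F (P *v v))" for c v
  proof -
    have "apply_triple F (A *v (P *v v)) = P *v ?E (D *v v)"
      by (simp add: F AP matrix_inv_cancel P)
    moreover have "c *s (A *v apply_triple F (P *v v)) = P *v (c *s (D *v ?E v))"
      by (simp add: F AP matrix_inv_cancel P vector_scalar_commute)
    ultimately show ?thesis using matrix_inv_cancel(4)[OF P] by metis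
  qed
  have onto: "(\<forall>v. X (P *v v)) \<longleftrightarrow> (\<forall>v. X v)" for X :: "'a^3 \<Rightarrow> bool"
    using matrix_inv_cancel(3)[OF P] by metis
  have "(\<forall>v. ?E (D *v v) = c *s (D *v ?E v)) \<longleftrightarrow>
      (\<forall>v. apply_triple F (A *v v) = c *s (A *v apply_triple F v))" for c
    unfolding pointwise by (rule onto)
  then show ?thesis unfolding equivariant_def by simp
qed

lemma regular_conj_triple:
  assumes F: "regular_triple F" and P: "invertible P"
  shows "regular_triple (conj_triple P F)"
  unfolding regular_triple_def
proof (intro conjI allI impI notI)
  let ?E = "apply_triple (conj_triple P F)" and ?Q = "matrix_inv P"
  have E: "?E (?Q *v v) = ?Q *v apply_triple F v" for v
    by (simp add: apply_conj_triple matrix_inv_cancel P)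
  have F': "apply_triple F v = P *v ?E (?Q *v v)" for v
    by (simp add: apply_conj_triple matrix_inv_cancel P)
  show "conj_triple P F \<in> quadratic_triples"
    using F by (simp add: regular_triple_def conj_triple_quadratic)
  show "l = 0" if l: "\<forall>v. (\<Sum>i\<in>UNIV. l $ i * ?E v $ i) = 0" for l
  proof -
    have "(\<Sum>i\<in>UNIV. (l v* ?Q) $ i * apply_triple F v $ i) = 0" for v
      using l[rule_format, of "?Q *v v"] by (simp add: E sum_mult_matrix_vector)
    then have "l v* ?Q = 0" using F unfolding regular_triple_def by blast
    then have "(l v* ?Q) v* P = 0" by simp
    then show "l = 0" by (simp add: vector_matrix_mul_assoc matrix_inv_inverse P)
  qed
  show False if "\<exists>l L. \<forall>v. ?E v = (\<Sum>i\<in>UNIV. l $ i * v $ i) *s (L *v v)"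
  proof -
    from that obtain l L where "\<And>v. ?E v = (\<Sum>i\<in>UNIV. l $ i * v $ i) *s (L *v v)" by blast
    then have "apply_triple F v
        = (\<Sum>i\<in>UNIV. (l v* ?Q) $ i * v $ i) *s ((P ** L ** ?Q) *v v)" for v
      by (simp add: F' sum_mult_matrix_vector vector_scalar_commute matrix_vector_mul_assoc[symmetric])
    then show False using F unfolding regular_triple_def by blast
  qed
  fix D assume D: "invertible D" "equivariant (conj_triple P F) D"
  let ?A = "P ** D ** ?Q"
  have AP: "?A ** P = P ** D"
    by (simp add: matrix_mul_assoc[symmetric] matrix_inv_inverse P)
  have "invertible ?A" by (simp add: D P invertible_mult invertible_matrix_inv)
  moreover have "equivariant F ?A" using equivariant_conj_triple[OF P AP] D(2) by simp
  ultimately obtain n c where n: "n > 0" "mpow ?A n = mat c"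
    using F unfolding regular_triple_def by blast
  have "P ** mpow D n = P ** mat c"
    using mpow_conj[OF AP, of n] by (simp add: n(2) mult_mat_eq)
  then have "mpow D n = mat c" using matrix_inv_cancel(2)[OF P] by metis
  then show "\<exists>n>0. \<exists>c. mpow D n = mat c" using n(1) by blast
qed

text \<open>If \<open>h\<close> and \<open>g h\<close> are homogeneous of the same degree, only the constant term of \<open>g\<close>
  contributes to the product.\<close>

lemma homogeneous_cofactor_constant:
  fixes g h :: "'a::comm_ring_1 mpoly3"
  assumes h: "homogeneous d h" and gh: "homogeneous d (g * h)"
  shows "g * h = Const (Poly_Mapping.lookup g 0) * h"
proof -
  define g0 where "g0 = Const (Poly_Mapping.lookup g 0)"
  have g0: "homogeneous d (g0 * h)"
    unfolding g0_def by (rule homogeneous_Const_mult[OF h])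
  have g': "(\<Sum>j\<in>UNIV. Poly_Mapping.lookup k j) > 0" if "k \<in> Poly_Mapping.keys (g - g0)" for k
  proof (rule ccontr)
    assume "\<not> ?thesis"
    then have "k = 0" by (intro poly_mapping_eqI) simp
    then show False using that
      by (simp add: in_keys_iff g0_def Const_def lookup_minus)
  qed
  have "Poly_Mapping.keys ((g - g0) * h) = {}"
  proof (rule ccontr)
    assume "Poly_Mapping.keys ((g - g0) * h) \<noteq> {}"
    then obtain m where m: "m \<in> Poly_Mapping.keys ((g - g0) * h)" by blast
    then obtain k l where kl: "m = k + l" "k \<in> Poly_Mapping.keys (g - g0)" "l \<in> Poly_Mapping.keys h"
      using keys_mult[of "g - g0" h] by blast
    have "(\<Sum>j\<in>UNIV. Poly_Mapping.lookup m j) > d"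
      using g'[OF kl(2)] h kl(3) by (simp add: kl(1) lookup_add sum.distrib homogeneous_def)
    moreover have "m \<in> Poly_Mapping.keys (g * h) \<union> Poly_Mapping.keys (g0 * h)"
      using m by (auto simp: left_diff_distrib lookup_minus in_keys_iff)
    ultimately show False using gh g0 by (auto simp: homogeneous_def)
  qed
  then have "(g - g0) * h = 0" by simp
  then show ?thesis by (simp add: g0_def left_diff_distrib)
qed

text \<open>The linear form with coefficient vector \<open>l\<close>.\<close>

definition linear_form :: "'a::comm_ring_1 ^ 3 \<Rightarrow> 'a mpoly3" where
  "linear_form l = (\<Sum>j\<in>UNIV. Const (l $ j) * Var j)"

lemma homogeneous_linear_form: "homogeneous 1 (linear_form l)"
  unfolding linear_form_def by (auto intro!: homogeneous_sum homogeneous_Const_mult homogeneous_Var)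

lemma eval_at_linear_form: "eval_at v (linear_form l) = (\<Sum>j\<in>UNIV. l $ j * v $ j)"
  by (simp add: linear_form_def eval_at_sum eval_at_mult)

lemma linear_form_not_unit: "\<not> linear_form l dvd (1 :: 'a::field mpoly3)"
proof
  assume "linear_form l dvd 1"
  then obtain q where "1 = linear_form l * q" by (rule dvdE)
  then have "eval_at 0 (1 :: 'a mpoly3) = eval_at 0 (linear_form l) * eval_at 0 q"
    by (metis eval_at_mult)
  then show False by (simp add: eval_at_linear_form)
qed

text \<open>A linear relation between the coordinates is a linear form that vanishes on the image, hence on
  the whole plane if the image is dense.\<close>

lemma dominant_coords_independent:
  fixes F :: "'a::field mpoly3 ^ 3"
  assumes "dominant (rat_class F)" and l: "\<And>v. (\<Sum>i\<in>UNIV. l $ i * apply_triple F v $ i) = 0"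
  shows "l = 0"
proof -
  have vanish: "\<forall>s\<in>rat_image (rat_class F). \<forall>w\<in>s. eval_at w (linear_form l) = 0"
  proof (intro ballI)
    fix s w assume "s \<in> rat_image (rat_class F)" "w \<in> s"
    then obtain c d v where "w = d *s (c *s apply_triple F v)"
      by (auto simp: rat_image_def rat_class_def P2_class_def apply_smult_triple)
    then have "eval_at w (linear_form l) = d * c * (\<Sum>i\<in>UNIV. l $ i * apply_triple F v $ i)"
      by (simp add: eval_at_linear_form sum_distrib_left ac_simps)
    then show "eval_at w (linear_form l) = 0" by (simp add: l)
  qed
  have "l $ i = 0" for i
  proof -
    have "axis i 1 \<noteq> (0 :: 'a^3)" by (simp add: axis_eq_0_iff)
    then have "P2_class (axis i 1) \<in> P2_closure (rat_image (rat_class F))"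
      using assms(1) by (auto simp: dominant_def P2_def)
    then have "\<forall>v\<in>P2_class (axis i 1). eval_at v (linear_form l) = 0"
      using vanish homogeneous_linear_form unfolding P2_closure_def by blast
    moreover have "axis i 1 \<in> P2_class (axis i (1::'a))"
      unfolding P2_class_def by (rule CollectI, rule exI[of _ 1]) simp
    ultimately have "eval_at (axis i 1) (linear_form l) = 0" by blast
    then show ?thesis
      by (simp add: eval_at_linear_form axis_def if_distrib[of "\<lambda>x. _ * x"] cong: if_cong)
  qed
  then show ?thesis by (simp add: vec_eq_iff)
qed

lemma degree_two_no_linear_factor:
  fixes F :: "'a::field mpoly3 ^ 3"
  assumes F: "F \<in> quadratic_triples" "F \<noteq> 0" and deg: "has_rat_degree (rat_class F) 2"
  shows "\<nexists>l L. \<forall>v. apply_triple F v = (\<Sum>i\<in>UNIV. l $ i * v $ i) *s (L *v v)"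
proof
  assume "\<exists>l L. \<forall>v. apply_triple F v = (\<Sum>i\<in>UNIV. l $ i * v $ i) *s (L *v v)"
  then obtain l L where lL: "\<And>v. apply_triple F v = (\<Sum>i\<in>UNIV. l $ i * v $ i) *s (L *v v)" by blast
  have F2: "homogeneous 2 (F $ i)" for i using F(1) by (simp add: quadratic_triples_def)
  have fac: "F $ i = linear_form l * linear_form (L $ i)" for i
  proof (rule quadratic_eqI)
    show "homogeneous 2 (linear_form l * linear_form (L $ i))"
      using homogeneous_mult[OF homogeneous_linear_form homogeneous_linear_form] by (simp add: numeral_2_eq_2)
    fix v
    have "eval_at v (F $ i) = apply_triple F v $ i" by (simp add: apply_triple_def)
    then show "eval_at v (F $ i) = eval_at v (linear_form l * linear_form (L $ i))"
      by (simp add: lL eval_at_mult eval_at_linear_form matrix_vector_mult_def)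
  qed (rule F2)
  obtain c g H where c: "c \<noteq> 0" and gH: "Const c *s F = g *s H"
    and H: "\<And>i. homogeneous 2 (H $ i)" and no: "\<And>q. (\<forall>i. q dvd H $ i) \<Longrightarrow> q dvd 1"
    using deg unfolding has_rat_degree_def rat_class_def by blast
  define g0 where "g0 = Poly_Mapping.lookup g 0"
  \<comment> \<open>As both sides have degree two, the removed factor \<open>g\<close> acts as its constant term.\<close>
  have eq: "Const c * F $ i = Const g0 * H $ i" for i
  proof -
    have *: "Const c * F $ i = g * H $ i" using gH by (simp add: vec_eq_iff)
    moreover have "homogeneous 2 (g * H $ i)"
      unfolding *[symmetric] by (rule homogeneous_Const_mult[OF F2])
    ultimately show ?thesis using homogeneous_cofactor_constant[OF H] by (simp add: g0_def)
  qed
  have CC: "Const (a * b) = Const a * Const b" for a b :: 'a by (simp add: Const_def mult_single)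
  have inv: "Const (inverse b) * (Const b * p) = p" if "b \<noteq> 0" for b :: 'a and p
    unfolding mult.assoc[symmetric] CC[symmetric] using that by (simp add: Const_def)
  have "g0 \<noteq> 0"
  proof
    assume "g0 = 0"
    then have "Const c * F $ i = 0" for i using eq by (simp add: Const_def)
    then have "F $ i = 0" for i using inv[OF c, of "F $ i"] by (metis mult_zero_right)
    then show False using F(2) by (simp add: vec_eq_iff)
  qed
  have "linear_form l dvd H $ i" for i
  proof -
    have "H $ i = linear_form l * (Const (inverse g0) * (Const c * linear_form (L $ i)))"
      using inv[OF \<open>g0 \<noteq> 0\<close>, of "H $ i"] by (simp add: eq[symmetric] fac ac_simps)
    then show ?thesis by (rule dvdI)
  qed
  then have "linear_form l dvd 1" by (intro no) blast
  then show False by (simp add: linear_form_not_unit)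
qed

text \<open>The powers of an equivariant matrix have only finitely many classes, so two of them coincide.\<close>

lemma finite_Aut_finite_order:
  fixes F :: "'a::field mpoly3 ^ 3"
  assumes F: "F \<in> quadratic_triples" and fin: "finite (rat_Aut (rat_class F))"
    and A: "invertible A" "equivariant F A"
  shows "\<exists>n>0. \<exists>c. mpow A n = mat c"
proof -
  have "pgl_class (mpow A n) \<in> rat_Aut (rat_class F)" for n
    using rat_Aut_iff_equivariant[OF F] mpow_invertible[OF A(1)] equivariant_mpow[OF A(2)] by blast
  then have "finite (range (\<lambda>n. pgl_class (mpow A n)))"
    by (intro finite_subset[OF _ fin]) auto
  then have "\<not> inj (\<lambda>n. pgl_class (mpow A n))" using finite_imageD by fastforce
  then obtain m n where mn: "m < n" "pgl_class (mpow A n) = pgl_class (mpow A m)"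
    unfolding inj_def by (metis linorder_neqE_nat)
  from mn(2) obtain c where c: "mpow A n = mat c ** mpow A m" by (rule pgl_class_eqD)
  have "mpow A n = mpow A m ** mpow A (n - m)"
    using mn(1) by (simp add: mpow_add[symmetric])
  then have "mpow A m ** mpow A (n - m) = mpow A m ** mat c"
    by (simp add: c mult_mat_eq)
  then have "mpow A (n - m) = mat c"
    using matrix_inv_cancel(2)[OF mpow_invertible[OF A(1)]] by metis
  then show ?thesis using mn(1) by (intro exI[of _ "n - m"]) auto
qed

lemma regular_lift:
  fixes f :: "('a::field mpoly3 ^ 3) set"
  assumes "f \<in> Rat22" "dominant f" "has_rat_degree f 2" "finite (rat_Aut f)"
  obtains F where "F \<in> quadratic_triples" "f = rat_class F" "regular_triple F"
proof -
  obtain F where F: "F \<in> quadratic_triples" "F \<noteq> 0" "f = rat_class F"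
    using assms(1) by (auto simp: Rat22_def)
  have "regular_triple F" unfolding regular_triple_def
    using F assms dominant_coords_independent[of F] degree_two_no_linear_factor[of F]
      finite_Aut_finite_order[of F] by blast
  then show ?thesis using that F by blast
qed

section \<open>Equivariant diagonal matrices\<close>

lemma diag3_eq_iff: "diag3 a b c = diag3 a' b' c' \<longleftrightarrow> a = a' \<and> b = b' \<and> c = c'"
  by (auto simp: diag3_def vec_eq_iff forall_3)

lemma diag3_mult: "diag3 a b c ** diag3 a' b' c' = diag3 (a * a') (b * b') (c * c')"
  by (auto simp: diag3_def vec_eq_iff forall_3 matrix_matrix_mult_def sum_3)

lemma mat_eq_diag3: "mat c = diag3 c c c"
  by (auto simp: diag3_def vec_eq_iff forall_3 mat_def)

lemma mpow_diag3: "mpow (diag3 a b c) n = diag3 (a ^ n) (b ^ n) (c ^ n)"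
  by (induction n) (auto simp: diag3_mult mat_eq_diag3)

lemma invertible_diag3: "a \<noteq> 0 \<Longrightarrow> b \<noteq> 0 \<Longrightarrow> c \<noteq> 0 \<Longrightarrow> invertible (diag3 a b c)"
  unfolding invertible_right_inverse
  by (rule exI[of _ "diag3 (inverse a) (inverse b) (inverse c)"]) (simp add: diag3_mult mat_eq_diag3)

lemma diag3_vector_mult: "diag3 a b c *v v = (\<chi> i. vector [a, b, c] $ i * v $ i)"
  by (auto simp: diag3_def vec_eq_iff forall_3 matrix_vector_mult_def sum_3)

text \<open>The value at the point \<open>d\<close> of the monomial with exponent vector \<open>m\<close>.\<close>

definition monomial_value :: "'a::comm_ring_1 ^ 3 \<Rightarrow> (3 \<Rightarrow>\<^sub>0 nat) \<Rightarrow> 'a" where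
  "monomial_value d m = (\<Prod>j\<in>UNIV. (d $ j) ^ Poly_Mapping.lookup m j)"

lemma monomial_value_3: "monomial_value d m =
    d $ 1 ^ Poly_Mapping.lookup m 1 * d $ 2 ^ Poly_Mapping.lookup m 2 * d $ 3 ^ Poly_Mapping.lookup m 3"
proof -
  have "(\<Prod>j\<in>UNIV. g j) = g 1 * g 2 * g 3" for g :: "3 \<Rightarrow> 'a"
    unfolding UNIV_3 by (simp add: mult.assoc)
  then show ?thesis by (simp add: monomial_value_def)
qed

lemma eval_at_diag:
  "eval_at (\<chi> i. d $ i * v $ i) p =
    (\<Sum>m\<in>Poly_Mapping.keys p. Poly_Mapping.lookup p m * monomial_value d m * monomial_value v m)"
  by (simp add: eval_along_def monomial_value_def power_mult_distrib prod.distrib mult.assoc)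

lemma equivariant_diag3_iff:
  fixes F :: "'a::field mpoly3 ^ 3"
  assumes F: "F \<in> quadratic_triples"
  shows "equivariant F (diag3 a b c) \<longleftrightarrow> (\<exists>s. s \<noteq> 0 \<and>
    (\<forall>i. \<forall>m\<in>Poly_Mapping.keys (F $ i). monomial_value (vector [a, b, c]) m = s * vector [a, b, c] $ i))"
proof -
  let ?d = "vector [a, b, c] :: 'a^3"
  have F2: "homogeneous 2 (F $ i)" for i using F by (simp add: quadratic_triples_def)
  have "(\<forall>v. eval_at (\<chi> i. ?d $ i * v $ i) (F $ i) = s * (?d $ i * eval_at v (F $ i)))
      \<longleftrightarrow> (\<forall>m\<in>Poly_Mapping.keys (F $ i). monomial_value ?d m = s * ?d $ i)" (is "?L \<longleftrightarrow> ?R") for s i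
  proof
    assume ?R
    then show ?L
      by (simp add: eval_at_diag)
         (simp add: eval_along_def monomial_value_def sum_distrib_left ac_simps)
  next
    assume L: ?L
    let ?p = "Poly_Mapping.mapp (\<lambda>m x. x * monomial_value ?d m) (F $ i)"
    have keys: "Poly_Mapping.keys ?p \<subseteq> Poly_Mapping.keys (F $ i)" by (rule keys_mapp_subset)
    have "?p = Const (s * ?d $ i) * F $ i"
    proof (rule quadratic_eqI)
      show "homogeneous 2 ?p" using F2[of i] keys unfolding homogeneous_def by blast
      show "homogeneous 2 (Const (s * ?d $ i) * F $ i)" by (rule homogeneous_Const_mult[OF F2])
      fix v
      have "eval_at v ?p = eval_at (\<chi> i. ?d $ i * v $ i) (F $ i)"
        by (subst eval_at_superset[OF finite_keys keys])
           (simp add: eval_at_diag lookup_mapp monomial_value_def)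
      then show "eval_at v ?p = eval_at v (Const (s * ?d $ i) * F $ i)"
        using L by (simp add: eval_at_mult)
    qed
    moreover have "Poly_Mapping.lookup (Const x * p) m = x * Poly_Mapping.lookup p m" for x p m
      using map_eq_zero_iff[of "(*) x"] mult_map_scale_conv_mult[of x p]
      by (simp add: Const_def Poly_Mapping.map.rep_eq when_def flip: mult_map_scale_conv_mult)
    ultimately have lk: "Poly_Mapping.lookup ?p m = s * ?d $ i * Poly_Mapping.lookup (F $ i) m" for m
      by simp
    have "x * monomial_value ?d m = s * ?d $ i * x"
      if "x = Poly_Mapping.lookup (F $ i) m" "m \<in> Poly_Mapping.keys (F $ i)" for x m
      using lk[of m] that by (simp add: lookup_mapp)
    then show ?R by (metis in_keys_iff mult.commute mult_left_cancel)
  qed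
  then show ?thesis
    unfolding equivariant_def diag3_vector_mult apply_triple_def vec_eq_iff by (simp, blast)
qed

lemma quadratic_key_cases:
  assumes "F \<in> quadratic_triples" "m \<in> Poly_Mapping.keys (F $ i)"
  shows "Poly_Mapping.lookup m 1 + Poly_Mapping.lookup m 2 + Poly_Mapping.lookup m 3 = 2"
  using assms unfolding quadratic_triples_def homogeneous_def by (auto simp: sum_3)

lemma two_powi_eq_1:
  assumes "(2::'a::field_char_0) powi k = 1" shows "k = 0"
proof -
  have "n = 0" if "(2::'a) ^ n = 1" for n
  proof -
    have "of_nat (2 ^ n) = (of_nat 1 :: 'a)" using that by simp
    then have "2 ^ n = (1::nat)" using of_nat_eq_iff by blast
    then show ?thesis by simp
  qed
  from this[of "nat k"] this[of "nat (- k)"] show ?thesis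
    using assms by (auto simp: power_int_def field_simps split: if_splits)
qed

text \<open>The powers of 2 with nonzero exponent are not roots of unity in characteristic 0, so the value 2 of
  the parameter suffices to detect an equivariant one-parameter torus.\<close>

lemma regular_no_infinite_torus:
  fixes E :: "'a::field_char_0 mpoly3 ^ 3"
  assumes E: "regular_triple E"
    and eq: "equivariant E (diag3 1 (2 powi \<alpha>) (2 powi \<beta>))"
  shows "\<alpha> = 0 \<and> \<beta> = 0"
proof -
  let ?D = "diag3 1 (2 powi \<alpha>) (2 powi \<beta>) :: 'a^3^3"
  have "invertible ?D" by (simp add: invertible_diag3)
  then obtain n c where n: "n > 0" "mpow ?D n = mat c"
    using E eq unfolding regular_triple_def by blast
  then have "((2::'a) powi \<alpha>) ^ n = 1" "((2::'a) powi \<beta>) ^ n = 1"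
    by (auto simp: mpow_diag3 mat_eq_diag3 diag3_eq_iff)
  then have "(2::'a) powi (\<alpha> * int n) = 1" "(2::'a) powi (\<beta> * int n) = 1"
    by (simp_all add: power_int_mult)
  then show ?thesis using two_powi_eq_1 n(1) by (metis mult_eq_0_iff of_nat_0_less_iff less_irrefl)
qed

section \<open>Diagonal matrices with a repeated eigenvalue\<close>

lemma apply_triple_quadratic:
  assumes "F \<in> quadratic_triples"
  shows "apply_triple F v $ i =
      Poly_Mapping.lookup (F $ i) (mono3 2 0 0) * (v $ 1)\<^sup>2 + Poly_Mapping.lookup (F $ i) (mono3 0 2 0) * (v $ 2)\<^sup>2
    + Poly_Mapping.lookup (F $ i) (mono3 0 0 2) * (v $ 3)\<^sup>2 + Poly_Mapping.lookup (F $ i) (mono3 1 1 0) * (v $ 1 * v $ 2)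
    + Poly_Mapping.lookup (F $ i) (mono3 1 0 1) * (v $ 1 * v $ 3) + Poly_Mapping.lookup (F $ i) (mono3 0 1 1) * (v $ 2 * v $ 3)"
  using assms by (simp add: apply_triple_def eval_at_quadratic quadratic_triples_def)

text \<open>A homology of the plane, i.e. a diagonal matrix with a repeated eigenvalue, is equivariant only if
  its square is scalar.  The monomials of \<open>E\<close> are separated by their exponent of \<open>Z\<close>.\<close>

lemma equivariant_homology_square:
  fixes E :: "'a::field_char_0 mpoly3 ^ 3"
  assumes E: "regular_triple E" and ab: "a \<noteq> 0" "b \<noteq> 0"
    and eq: "equivariant E (diag3 a a b)"
  shows "a\<^sup>2 = b\<^sup>2"
proof (rule ccontr)
  assume neq: "a\<^sup>2 \<noteq> b\<^sup>2"
  have Eq: "E \<in> quadratic_triples" using E by (simp add: regular_triple_def)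
  obtain s where s: "s \<noteq> 0" "\<And>i m. m \<in> Poly_Mapping.keys (E $ i) \<Longrightarrow>
      monomial_value (vector [a, a, b]) m = s * vector [a, a, b] $ i"
    using eq unfolding equivariant_diag3_iff[OF Eq] by blast
  have val: "monomial_value (vector [a, a, b]) m = a ^ (2 - Poly_Mapping.lookup m 3) * b ^ Poly_Mapping.lookup m 3"
    and le: "Poly_Mapping.lookup m 3 = 0 \<or> Poly_Mapping.lookup m 3 = 1 \<or> Poly_Mapping.lookup m 3 = 2"
    if "m \<in> Poly_Mapping.keys (E $ i)" for i m
  proof -
    have "Poly_Mapping.lookup m 1 + Poly_Mapping.lookup m 2 = 2 - Poly_Mapping.lookup m 3"
      using quadratic_key_cases[OF Eq that] by simp
    then show "monomial_value (vector [a, a, b]) m = a ^ (2 - Poly_Mapping.lookup m 3) * b ^ Poly_Mapping.lookup m 3"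
      by (simp add: monomial_value_3 power_add[symmetric])
    show "Poly_Mapping.lookup m 3 = 0 \<or> Poly_Mapping.lookup m 3 = 1 \<or> Poly_Mapping.lookup m 3 = 2"
      using quadratic_key_cases[OF Eq that] by linarith
  qed
  have upper: "Poly_Mapping.lookup m 3 = 0 \<and> s = a \<or> Poly_Mapping.lookup m 3 = 1 \<and> s = b
      \<or> Poly_Mapping.lookup m 3 = 2 \<and> b\<^sup>2 = s * a"
    if "m \<in> Poly_Mapping.keys (E $ i)" "i = 1 \<or> i = 2" for i m
    using s(2)[OF that(1)] le[OF that(1)] that(2) ab
    by (auto simp: val[OF that(1)] power2_eq_square)
  have lower: "Poly_Mapping.lookup m 3 = 0 \<and> a\<^sup>2 = s * b \<or> Poly_Mapping.lookup m 3 = 1 \<and> s = a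
      \<or> Poly_Mapping.lookup m 3 = 2 \<and> s = b"
    if "m \<in> Poly_Mapping.keys (E $ 3)" for m
    using s(2)[OF that(1)] le[OF that(1)] ab
    by (auto simp: val[OF that(1)] power2_eq_square)
  have "a \<noteq> b" using neq by auto
  consider "s = a" | "s = b" | "s \<noteq> a" "s \<noteq> b" by blast
  then show False
  proof cases
    case 1
    \<comment> \<open>The first two coordinates involve only \<open>X, Y\<close>, and the third is \<open>Z\<close> times a form in \<open>X, Y\<close>.\<close>
    have "equivariant E (diag3 1 (2 powi 0) (2 powi 1))"
      unfolding equivariant_diag3_iff[OF Eq]
    proof (intro exI[of _ 1] conjI allI ballI)
      fix i m assume m: "m \<in> Poly_Mapping.keys (E $ i)"
      show "monomial_value (vector [1, 2 powi 0, 2 powi 1]) m = 1 * vector [1, 2 powi 0, 2 powi 1] $ (i::3) "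
        using upper[OF m] lower[of m] m exhaust_3[of i] \<open>a \<noteq> b\<close> neq ab 1
        by (auto simp: monomial_value_3 power2_eq_square)
    qed simp
    then show False using regular_no_infinite_torus[OF E, of 0 1] by simp
  next
    case 2
    \<comment> \<open>Every monomial of every coordinate is divisible by \<open>Z\<close>.\<close>
    have "Poly_Mapping.lookup m 3 \<noteq> 0" if "m \<in> Poly_Mapping.keys (E $ i)" for i m
      using upper[OF that] lower[of m] that exhaust_3[of i] \<open>a \<noteq> b\<close> neq ab 2
      by (auto simp: power2_eq_square)
    then have "Poly_Mapping.lookup (E $ i) (mono3 2 0 0) = 0" "Poly_Mapping.lookup (E $ i) (mono3 0 2 0) = 0"
      "Poly_Mapping.lookup (E $ i) (mono3 1 1 0) = 0" for i
      by (metis in_keys_iff lookup_mono3(3))+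
    then have "apply_triple E v = (\<Sum>i\<in>UNIV. vector [0, 0, 1] $ i * v $ i) *s
        ((\<chi> i. vector [Poly_Mapping.lookup (E $ i) (mono3 1 0 1), Poly_Mapping.lookup (E $ i) (mono3 0 1 1),
            Poly_Mapping.lookup (E $ i) (mono3 0 0 2)]) *v v)" for v
      by (simp add: vec_eq_iff apply_triple_quadratic[OF Eq] matrix_vector_mult_def sum_3
          algebra_simps power2_eq_square)
    then show False using E unfolding regular_triple_def by blast
  next
    case 3
    \<comment> \<open>The first two coordinates are multiples of \<open>Z\<^sup>2\<close>, hence linearly dependent.\<close>
    have "Poly_Mapping.lookup (E $ i) (mono3 n k r) = 0" if "i = 1 \<or> i = 2" "r \<noteq> 2" for i n k r
      using upper[of "mono3 n k r" i] that 3 by (auto simp: in_keys_iff)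
    then have EE: "apply_triple E v $ i = Poly_Mapping.lookup (E $ i) (mono3 0 0 2) * (v $ 3)\<^sup>2"
      if "i = 1 \<or> i = 2" for i v
      using that by (simp add: apply_triple_quadratic[OF Eq])
    define p q where "p = Poly_Mapping.lookup (E $ 1) (mono3 0 0 2)"
      and "q = Poly_Mapping.lookup (E $ 2) (mono3 0 0 2)"
    \<comment> \<open>The first two coordinates are \<open>p Z\<^sup>2\<close> and \<open>q Z\<^sup>2\<close>; the relation is nontrivial also for \<open>p = q = 0\<close>.\<close>
    define l :: "'a^3" where "l = (if p = 0 then vector [1, 0, 0] else vector [q, - p, 0])"
    have "(\<Sum>i\<in>UNIV. l $ i * apply_triple E v $ i) = 0" for v
      by (simp add: sum_3 l_def EE p_def[symmetric] q_def[symmetric])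
    then have "l = 0" using E unfolding regular_triple_def by blast
    then show False by (auto simp: l_def vec_eq_iff forall_3 split: if_splits)
  qed
qed

section \<open>Diagonal matrices of large prime order\<close>

text \<open>The characters \<open>\<epsilon>\<^sub>j + \<epsilon>\<^sub>k - \<epsilon>\<^sub>i\<close> of the diagonal torus on triples of quadratic forms.  Their three
  entries add up to 1, so the first one is dropped.\<close>

definition torus_chars :: "(int \<times> int) list" where
  "torus_chars = [(-1,0),(0,-1),(2,0),(2,-1),(0,2),(-1,2),(0,0),(1,0),(0,1),(1,-1),(-1,1),(1,1)]"

text \<open>Twice the signed area of a triangle with lattice vertices.\<close>

fun area :: "int \<times> int \<Rightarrow> int \<times> int \<Rightarrow> int \<times> int \<Rightarrow> int" where
  "area (a, b) (c, d) (e, f) = (c - a) * (f - b) - (d - b) * (e - a)"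

text \<open>Exhaustive inspection of the triangles: the doubled area is at most 7, and up to the order of the
  vertices it is attained only by the triangle on \<open>(0,-1), (2,0), (-1,2)\<close> and the one on
  \<open>(-1,0), (2,-1), (0,2)\<close>; two vertices are enough to recognize each.\<close>

lemma area_check_list:
  "list_all (\<lambda>P. list_all (\<lambda>Q. list_all (\<lambda>R.
     \<bar>area P Q R\<bar> < 7 \<or> \<bar>area P Q R\<bar> = 7 \<and>
       ((P = (0, -1) \<or> Q = (0, -1) \<or> R = (0, -1)) \<and> (P = (2, 0) \<or> Q = (2, 0) \<or> R = (2, 0)) \<or>
        (P = (-1, 0) \<or> Q = (-1, 0) \<or> R = (-1, 0)) \<and> (P = (0, 2) \<or> Q = (0, 2) \<or> R = (0, 2))))
       torus_chars) torus_chars) torus_chars"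
  by code_simp

lemma area_bound:
  assumes "P \<in> set torus_chars" "Q \<in> set torus_chars" "R \<in> set torus_chars" "\<bar>area P Q R\<bar> \<ge> 7"
  shows "\<bar>area P Q R\<bar> = 7 \<and>
    ((0, -1) \<in> {P, Q, R} \<and> (2, 0) \<in> {P, Q, R} \<or> (-1, 0) \<in> {P, Q, R} \<and> (0, 2) \<in> {P, Q, R})"
  using area_check_list[unfolded list_all_iff, rule_format, OF assms(1-3)] assms(4) by auto

lemma dvd_of_power_int_eq_1:
  fixes x :: "'a::field"
  assumes p: "prime p" and x: "x ^ p = 1" "x \<noteq> 1" and k: "x powi k = 1"
  shows "int p dvd k"
proof (rule ccontr)
  assume "\<not> int p dvd k"
  then have "coprime (int p) k" using p by (simp add: prime_imp_coprime)
  then obtain u v where uv: "u * int p + v * k = 1"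
    using bezout_int[of "int p" k] by (auto simp: coprime_iff_gcd_eq_1)
  have x0: "x \<noteq> 0" using x(1) p by (auto simp: power_0_left prime_gt_0_nat split: if_splits)
  have "x = x powi (u * int p + v * k)" using uv by simp
  also have "\<dots> = (x powi int p) powi u * (x powi k) powi v"
    using x0 by (simp only: power_int_add power_int_mult mult.commute[of u] mult.commute[of v] simp_thms)
  also have "\<dots> = 1" using x(1) k by simp
  finally show False using x(2) by simp
qed

lemma collinear_points:
  fixes S :: "(int \<times> int) set"
  assumes col: "\<And>P Q R. P \<in> S \<Longrightarrow> Q \<in> S \<Longrightarrow> R \<in> S \<Longrightarrow> area P Q R = 0"
  obtains \<alpha> \<beta> e where "(\<alpha>, \<beta>) \<noteq> (0, 0)" "\<And>u v. (u, v) \<in> S \<Longrightarrow> \<alpha> * u + \<beta> * v = e"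
proof (cases "\<exists>P\<in>S. \<exists>Q\<in>S. P \<noteq> Q")
  case True
  then obtain a b c d where PQ: "(a, b) \<in> S" "(c, d) \<in> S" "(a, b) \<noteq> (c, d)" by (metis surj_pair)
  show ?thesis
  proof (rule that[of "d - b" "a - c" "(d - b) * a + (a - c) * b"])
    show "(d - b, a - c) \<noteq> (0, 0)" using PQ(3) by auto
    fix u v assume "(u, v) \<in> S"
    from col[OF PQ(1,2) this] show "(d - b) * u + (a - c) * v = (d - b) * a + (a - c) * b"
      by (simp add: algebra_simps)
  qed
next
  case False
  then obtain a b where "S \<subseteq> {(a, b)}" by (cases "S = {}") auto
  then show ?thesis by (intro that[of 1 0 a]) auto
qed

text \<open>The character, without its first entry, of the monomial with exponents \<open>m\<close> in the coordinate \<open>i\<close>.\<close>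

definition char_of :: "3 \<Rightarrow> (3 \<Rightarrow>\<^sub>0 nat) \<Rightarrow> int \<times> int" where
  "char_of i m = (int (Poly_Mapping.lookup m 2) - of_bool (i = 2), int (Poly_Mapping.lookup m 3) - of_bool (i = 3))"

lemma char_of_in_torus_chars:
  assumes "F \<in> quadratic_triples" "m \<in> Poly_Mapping.keys (F $ i)"
  shows "char_of i m \<in> set torus_chars"
proof -
  have "a = 2 \<and> b = 0 \<and> c = 0 \<or> a = 0 \<and> b = 2 \<and> c = 0 \<or> a = 0 \<and> b = 0 \<and> c = 2
     \<or> a = 1 \<and> b = 1 \<and> c = 0 \<or> a = 1 \<and> b = 0 \<and> c = 1 \<or> a = 0 \<and> b = 1 \<and> c = 1"
    if "a + b + c = (2::nat)" for a b c
    using that by presburger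
  from this[OF quadratic_key_cases[OF assms]] show ?thesis
    using exhaust_3[of i] unfolding char_of_def torus_chars_def by (elim disjE conjE) simp_all
qed

lemma monomial_value_char:
  fixes x y :: "'a::field"
  assumes "x \<noteq> 0" "y \<noteq> 0"
  shows "monomial_value (vector [1, x, y]) m = s * vector [1, x, y] $ i \<longleftrightarrow>
    x powi fst (char_of i m) * y powi snd (char_of i m) = s"
  using assms exhaust_3[of i]
  by (auto simp: char_of_def monomial_value_3 power_int_diff field_simps)

lemma equivariant_large_prime:
  fixes E :: "'a::field_char_0 mpoly3 ^ 3"
  assumes E: "regular_triple E" and p: "prime p" "p \<ge> 7"
    and xy: "x ^ p = 1" "y ^ p = 1" "x \<noteq> 1"
    and eq: "equivariant E (diag3 1 x y)"
  shows "p = 7 \<and> (y = x ^ 5 \<or> x = y ^ 5)"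
proof -
  have Eq: "E \<in> quadratic_triples" using E by (simp add: regular_triple_def)
  have x0: "x \<noteq> 0" and y0: "y \<noteq> 0"
    using xy p(2) by (auto simp: power_0_left split: if_splits)
  define S where "S = {char_of i m | i m. m \<in> Poly_Mapping.keys (E $ i)}"
  have S_chars: "S \<subseteq> set torus_chars" using char_of_in_torus_chars[OF Eq] by (auto simp: S_def)
  have equi: "equivariant E (diag3 1 a b) \<longleftrightarrow>
      (\<exists>s. s \<noteq> 0 \<and> (\<forall>(u, v)\<in>S. a powi u * b powi v = s))" if "a \<noteq> 0" "b \<noteq> 0" for a b
    unfolding equivariant_diag3_iff[OF Eq] monomial_value_char[OF that] S_def case_prod_unfold by blast
  obtain s where s0: "s \<noteq> 0" and s: "\<And>u v. (u, v) \<in> S \<Longrightarrow> x powi u * y powi v = s"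
    using eq unfolding equi[OF x0 y0] by blast
  have dvd: "int p dvd area P Q R" if "P \<in> S" "Q \<in> S" "R \<in> S" for P Q R
  proof -
    obtain a b c d e f where PQR: "P = (a, b)" "Q = (c, d)" "R = (e, f)" by (metis surj_pair)
    have 1: "x powi (c - a) * y powi (d - b) = 1"
      using s[of a b] s[of c d] that s0 x0 y0 by (simp add: PQR power_int_diff field_simps)
    have 2: "x powi (e - a) * y powi (f - b) = 1"
      using s[of a b] s[of e f] that s0 x0 y0 by (simp add: PQR power_int_diff field_simps)
    \<comment> \<open>Eliminating \<open>y\<close> from the two relations leaves \<open>x\<close> to the power of the doubled area.\<close>
    have "x powi ((c - a) * (f - b)) * y powi ((d - b) * (f - b)) = 1"
      by (simp only: power_int_mult power_int_mult_distrib[symmetric] 1 power_int_1_left)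
    moreover have "x powi ((e - a) * (d - b)) * y powi ((f - b) * (d - b)) = 1"
      by (simp only: power_int_mult power_int_mult_distrib[symmetric] 2 power_int_1_left)
    ultimately have "x powi ((c - a) * (f - b)) = x powi ((e - a) * (d - b))"
      using y0 by (metis mult.commute mult_right_cancel power_int_not_zero)
    then have "x powi ((c - a) * (f - b) - (e - a) * (d - b)) = 1"
      using x0 by (simp add: power_int_diff)
    then show ?thesis
      using dvd_of_power_int_eq_1[OF p(1) xy(1,3)] by (simp add: PQR mult.commute)
  qed
  obtain P Q R where PQR: "P \<in> S" "Q \<in> S" "R \<in> S" "area P Q R \<noteq> 0"
  proof (rule ccontr)
    assume "\<not> thesis"
    then have "\<And>P Q R. P \<in> S \<Longrightarrow> Q \<in> S \<Longrightarrow> R \<in> S \<Longrightarrow> area P Q R = 0" using that by blast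
    then obtain \<alpha> \<beta> e where ab: "(\<alpha>, \<beta>) \<noteq> (0, 0)" "\<And>u v. (u, v) \<in> S \<Longrightarrow> \<alpha> * u + \<beta> * v = e"
      by (rule collinear_points[of S]) blast+
    have "equivariant E (diag3 1 (2 powi \<alpha>) (2 powi \<beta>))"
    proof (subst equi; (intro exI[of _ "2 powi e"] conjI)?)
      show "\<forall>(u, v)\<in>S. (2 powi \<alpha>) powi u * (2 powi \<beta>) powi v = (2 powi e :: 'a)"
        by (auto simp flip: power_int_mult power_int_add simp: ab(2))
    qed auto
    then show False using regular_no_infinite_torus[OF E] ab(1) by blast
  qed
  have "\<bar>area P Q R\<bar> \<ge> int p" using dvd[OF PQR(1-3)] PQR(4) by (metis dvd_imp_le_int abs_of_nat)
  then have "\<bar>area P Q R\<bar> \<ge> 7" using p(2) by simp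
  from area_bound[OF _ _ _ this] PQR(1-3) S_chars
  have area: "\<bar>area P Q R\<bar> = 7"
    and pts: "(0, -1) \<in> {P, Q, R} \<and> (2, 0) \<in> {P, Q, R} \<or> (-1, 0) \<in> {P, Q, R} \<and> (0, 2) \<in> {P, Q, R}"
    by blast+
  have "p = 7" using \<open>\<bar>area P Q R\<bar> \<ge> int p\<close> area p(2) by simp
  from pts have "(0, -1) \<in> S \<and> (2, 0) \<in> S \<or> (-1, 0) \<in> S \<and> (0, 2) \<in> S"
    using subsetD[of "{P, Q, R}" S] PQR(1-3) by (metis empty_subsetI insert_subset)
  then have "x\<^sup>2 * y = 1 \<or> x * y\<^sup>2 = 1"
  proof
    assume "(0, -1) \<in> S \<and> (2, 0) \<in> S"
    then have "inverse y = x\<^sup>2" using s[of 0 "-1"] s[of 2 0] by (simp add: power_int_minus)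
    then have "x\<^sup>2 * y = 1" using y0 by (simp flip: \<open>inverse y = x\<^sup>2\<close>)
    then show ?thesis ..
  next
    assume "(-1, 0) \<in> S \<and> (0, 2) \<in> S"
    then have "inverse x = y\<^sup>2" using s[of "-1" 0] s[of 0 2] by (simp add: power_int_minus)
    then have "x * y\<^sup>2 = 1" using x0 by (simp flip: \<open>inverse x = y\<^sup>2\<close>)
    then show ?thesis ..
  qed
  moreover have "y = x ^ 5" if "x\<^sup>2 * y = 1"
  proof -
    have "y = x ^ 7 * y" using xy(1) \<open>p = 7\<close> by simp
    also have "\<dots> = x ^ 5 * (x\<^sup>2 * y)" by (simp add: power_add[symmetric] mult.assoc[symmetric])
    finally show ?thesis using that by simp
  qed
  moreover have "x = y ^ 5" if "x * y\<^sup>2 = 1"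
  proof -
    have "x = y ^ 7 * x" using xy(2) \<open>p = 7\<close> by simp
    also have "\<dots> = y ^ 5 * (x * y\<^sup>2)" by (simp add: power_add[symmetric] mult.assoc[symmetric] mult.commute[of x])
    finally show ?thesis using that by simp
  qed
  ultimately show ?thesis using \<open>p = 7\<close> by blast
qed

section \<open>Diagonalization of elements of finite order\<close>

text \<open>A spanning set contains a basis, whose elements form the columns of an invertible matrix.\<close>

lemma eigenbasis_matrix:
  fixes S :: "('a::field^'n) set"
  assumes "vec.span S = UNIV"
  shows "\<exists>P :: 'a^'n^'n. invertible P \<and> (\<forall>j. column j P \<in> S)"
proof -
  obtain B where B: "B \<subseteq> S" "vec.independent B" "S \<subseteq> vec.span B" "card B = vec.dim S"
    using vec.basis_exists[of S] by metis
  have span: "vec.span B = UNIV"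
    using B(3) assms vec.span_mono[OF B(3)] by (simp add: vec.span_span top.extremum_uniqueI)
  have "vec.dim S = vec.dim (vec.span S)" by (simp add: vec.dim_span)
  then have "vec.dim S = CARD('n)" by (simp add: assms card_cart_basis)
  then have "card B = card (UNIV :: 'n set)" using B(4) by simp
  moreover have "finite B" using B(2) by (rule vec.finiteI_independent)
  ultimately obtain f where f: "bij_betw f (UNIV :: 'n set) B"
    using finite_same_card_bij[of "UNIV :: 'n set" B] by auto
  define P :: "'a^'n^'n" where "P = (\<chi> i j. f j $ i)"
  have col: "column j P = f j" for j by (simp add: P_def column_def vec_eq_iff)
  have "columns P = B" using f by (auto simp: columns_def col bij_betw_def)
  then have "invertible P"
    unfolding invertible_right_inverse matrix_right_invertible_span_columns by (simp add: span)
  then show ?thesis using f B(1) by (intro exI[of _ P]) (auto simp: col bij_betw_def)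
qed

lemma columns_eigenvectors:
  assumes "\<And>j. A *v column j P = r j *s column j (P :: 'a::field^3^3)"
  shows "A ** P = P ** diag3 (r 1) (r 2) (r 3)"
proof -
  have "(A ** P) $ i $ j = r j * P $ i $ j" for i j
    using assms[of j] by (simp add: vec_eq_iff matrix_matrix_mult_def matrix_vector_mult_def column_def)
  then show ?thesis
    by (simp add: vec_eq_iff forall_3) (simp add: matrix_matrix_mult_def diag3_def sum_3 mult.commute)
qed

lemma sum_powers_root_of_unity:
  fixes z :: "'a::field"
  assumes "primitive_root_of_unity n z" "j < n"
  shows "(\<Sum>k<n. (z ^ j) ^ k) = (if j = 0 then of_nat n else 0)"
proof (cases "j = 0")
  case False
  then have "z ^ j \<noteq> 1" using assms by (auto simp: primitive_root_of_unity_def)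
  moreover have "(z ^ j) ^ n = 1"
    using assms(1) by (metis power_mult mult.commute power_one primitive_root_of_unity_def)
  ultimately show ?thesis using False by (simp add: geometric_sum)
qed simp

text \<open>The discrete Fourier transform of the orbit of \<open>v\<close> under \<open>A\<close> consists of eigenvectors, and
  its sum is \<open>n v\<close>.\<close>

lemma span_eigenvectors_finite_order:
  fixes A :: "'a::field_char_0^'n^'n" and z :: 'a
  assumes z: "primitive_root_of_unity n z" and A: "mpow A n = mat 1"
  shows "vec.span {v. \<exists>r. A *v v = r *s v} = UNIV"
proof -
  have n: "n > 0" and z0: "z \<noteq> 0" and zn: "z ^ n = 1"
    using z by (auto simp: primitive_root_of_unity_def power_0_left)
  have "v \<in> vec.span {v. \<exists>r. A *v v = r *s v}" for v
  proof -
    define w where "w k = (\<Sum>j<n. (z ^ k) ^ j *s (mpow A j *v v))" for k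
    have "A *v w k = inverse (z ^ k) *s w k" for k
    proof -
      let ?t = "\<lambda>j. (z ^ k) ^ j *s (mpow A j *v v)"
      have "z ^ k *s (A *v w k) = (\<Sum>j<n. ?t (Suc j))"
        by (simp add: w_def vec.linear_sum[OF matrix_vector_mul_linear_gen] vec.scale_sum_right
            vector_scalar_commute matrix_vector_mul_assoc)
      also have "\<dots> = (\<Sum>j<n. ?t j) + ?t n - ?t 0"
        using sum.lessThan_Suc_shift[of ?t n] by simp
      also have "?t n = ?t 0"
        using zn by (simp add: A) (metis power_commutes power_mult mult.commute power_one vec.scale_one)
      finally have *: "z ^ k *s (A *v w k) = w k" by (simp add: w_def)
      have "A *v w k = inverse (z ^ k) *s (z ^ k *s (A *v w k))"
        using z0 by (simp add: vector_smult_assoc)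
      then show ?thesis by (simp add: *)
    qed
    then have w: "w k \<in> {v. \<exists>r. A *v v = r *s v}" for k by blast
    have "(\<Sum>k<n. w k) = (\<Sum>j<n. \<Sum>k<n. (z ^ k) ^ j *s (mpow A j *v v))"
      unfolding w_def by (rule sum.swap)
    also have "\<dots> = (\<Sum>j<n. (\<Sum>k<n. (z ^ j) ^ k) *s (mpow A j *v v))"
      by (simp add: vec.scale_sum_left power_mult[symmetric] mult.commute)
    also have "\<dots> = (\<Sum>j<n. (if j = 0 then of_nat n *s v else 0))"
      by (rule sum.cong) (auto simp: sum_powers_root_of_unity[OF z])
    also have "\<dots> = of_nat n *s v" using n by simp
    finally have "v = inverse (of_nat n) *s (\<Sum>k<n. w k)"
      using n by (simp add: vector_smult_assoc)
    then show ?thesis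
      using w by (metis (no_types, lifting) vec.span_scale vec.span_sum vec.span_base)
  qed
  then show ?thesis by blast
qed

lemma span_common_eigenvectors_involutions:
  fixes A B :: "'a::field_char_0^'n^'n"
  assumes A: "A ** A = mat 1" and B: "B ** B = mat 1" and AB: "A ** B = B ** A"
  shows "vec.span {v. \<exists>r s. A *v v = r *s v \<and> B *v v = s *s v} = UNIV"
proof -
  let ?S = "{v. \<exists>r s. A *v v = r *s v \<and> B *v v = s *s v}"
  have AA: "A *v (A *v v) = v" and BB: "B *v (B *v v) = v" and BA: "B *v (A *v v) = A *v (B *v v)" for v
    by (simp_all add: matrix_vector_mul_assoc A B AB)
  have "v \<in> vec.span ?S" for v
  proof -
    define w where "w r s = v + r *s (A *v v) + s *s (B *v v) + (r * s) *s (A *v (B *v v))" for r s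
    have w: "w r s \<in> ?S" if "r * r = 1" "s * s = 1" for r s
    proof -
      have 1: "r * (r * c) = c" "s * (s * c) = c" "r * (s * (s * c)) = r * c" "s * (r * (s * c)) = r * c"
        "s * (r * (r * c)) = s * c" "r * (s * (r * c)) = s * c" for c
        using that by (metis mult.assoc mult.left_commute mult.left_neutral)+
      have "A *v w r s = r *s w r s \<and> B *v w r s = s *s w r s"
        by (simp add: w_def matrix_vector_right_distrib vector_scalar_commute AA BB BA)
           (simp add: vec_eq_iff algebra_simps 1)
      then show ?thesis by blast
    qed
    have "inverse 4 *s (w 1 1 + w 1 (-1) + w (-1) 1 + w (-1) (-1)) = v"
      by (simp add: w_def vec_eq_iff)
    moreover have "inverse 4 *s (w 1 1 + w 1 (-1) + w (-1) 1 + w (-1) (-1)) \<in> vec.span ?S"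
      by (intro vec.span_scale vec.span_add vec.span_base w) auto
    ultimately show ?thesis by simp
  qed
  then show ?thesis by blast
qed

text \<open>Over an algebraically closed field, an element of order dividing \<open>n\<close> lifts to a matrix with the same property.\<close>

lemma pgl_element_lift:
  fixes g :: "('a::alg_closed_field^3^3) set"
  assumes g: "g \<in> carrier PGL3" and gn: "g [^]\<^bsub>PGL3\<^esub> n = \<one>\<^bsub>PGL3\<^esub>" and n: "n > 0"
  obtains A where "invertible A" "g = pgl_class A" "mpow A n = mat 1"
proof -
  obtain A0 where A0: "invertible A0" "g = pgl_class A0" using g by (auto simp: carrier_PGL3)
  have "pgl_class (mpow A0 n) = pgl_class (mat 1)"
    using gn by (simp add: A0 pgl_class_pow pgl_class_one)
  then obtain c where c: "c \<noteq> 0" "mpow A0 n = mat c" by (elim pgl_class_eqD) auto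
  obtain b where b: "b ^ n = inverse c" using nth_root_exists[OF n] by blast
  have "b \<noteq> 0" using b c(1) n by (auto simp: power_0_left)
  show ?thesis
  proof (rule that)
    show "invertible (mat b ** A0)" using A0(1) \<open>b \<noteq> 0\<close> by (simp add: invertible_mult invertible_mat)
    show "g = pgl_class (mat b ** A0)" using \<open>b \<noteq> 0\<close> by (simp add: pgl_class_scale A0(2))
    show "mpow (mat b ** A0) n = mat 1" using b c by (simp add: mpow_scale mat_mult_mat)
  qed
qed

section \<open>Conjugates of a group that contain a given diagonal class\<close>

text \<open>Some conjugate of \<open>G\<close> contains the class of the diagonal matrix with entries \<open>a, b, c\<close>.  The
  condition is symmetric in the entries, homogeneous, and stable under powers if \<open>G\<close> is a
  subgroup.\<close>

definition diag_in :: "('a::field^3^3) set set \<Rightarrow> 'a \<Rightarrow> 'a \<Rightarrow> 'a \<Rightarrow> bool" where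
  "diag_in G a b c \<longleftrightarrow>
    (\<exists>A P. invertible A \<and> pgl_class A \<in> G \<and> invertible P \<and> A ** P = P ** diag3 a b c)"

text \<open>The involution \<open>S\<close> stands for a transposition of the coordinates.\<close>

lemma diag_in_permute:
  assumes "diag_in G a b c"
    and S: "S ** S = mat 1" "diag3 a b c ** S = S ** diag3 a' b' c'"
  shows "diag_in G a' b' c'"
proof -
  obtain A P where AP: "invertible A" "pgl_class A \<in> G" "invertible P" "A ** P = P ** diag3 a b c"
    using assms(1) unfolding diag_in_def by blast
  have "A ** (P ** S) = (P ** S) ** diag3 a' b' c'"
    by (metis AP(4) S(2) matrix_mul_assoc)
  moreover have "invertible (P ** S)"
    using AP(3) S(1) by (metis invertible_mult invertible_right_inverse)
  ultimately show ?thesis using AP unfolding diag_in_def by blast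
qed

lemma diag_in_swap12: "diag_in G a b c \<Longrightarrow> diag_in G b a c"
  by (erule diag_in_permute[where S = "\<chi> i j. of_bool (i = 1 \<and> j = 2 \<or> i = 2 \<and> j = 1 \<or> i = 3 \<and> j = 3)"])
     (simp_all add: vec_eq_iff forall_3 matrix_matrix_mult_def sum_3 mat_def diag3_def)

lemma diag_in_swap23: "diag_in G a b c \<Longrightarrow> diag_in G a c b"
  by (erule diag_in_permute[where S = "\<chi> i j. of_bool (i = 2 \<and> j = 3 \<or> i = 3 \<and> j = 2 \<or> i = 1 \<and> j = 1)"])
     (simp_all add: vec_eq_iff forall_3 matrix_matrix_mult_def sum_3 mat_def diag3_def)

lemma diag_in_permutations:
  assumes "diag_in G a b c"
  shows "diag_in G a c b" "diag_in G b a c" "diag_in G b c a" "diag_in G c a b" "diag_in G c b a"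
  using assms diag_in_swap12 diag_in_swap23 by metis+

lemma diag_in_scale:
  assumes "diag_in G a b c" "s \<noteq> 0" shows "diag_in G (s * a) (s * b) (s * c)"
proof -
  obtain A P where AP: "invertible A" "pgl_class A \<in> G" "invertible P" "A ** P = P ** diag3 a b c"
    using assms(1) unfolding diag_in_def by blast
  have "(mat s ** A) ** P = mat s ** (P ** diag3 a b c)" by (simp add: AP(4) matrix_mul_assoc[symmetric])
  also have "\<dots> = P ** (mat s ** diag3 a b c)" by (metis matrix_mul_assoc mult_mat_eq)
  also have "mat s ** diag3 a b c = diag3 (s * a) (s * b) (s * c)" by (simp add: mat_eq_diag3 diag3_mult)
  finally have "(mat s ** A) ** P = P ** diag3 (s * a) (s * b) (s * c)" .
  moreover have "invertible (mat s ** A)" "pgl_class (mat s ** A) \<in> G"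
    using AP assms(2) by (simp_all add: invertible_mult invertible_mat pgl_class_scale)
  ultimately show ?thesis using AP(3) unfolding diag_in_def by blast
qed

lemma pgl_class_mpow_in:
  assumes G: "subgroup G PGL3" and A: "invertible A" "pgl_class A \<in> G"
  shows "pgl_class (mpow A n) \<in> G"
proof (induction n)
  case 0
  then show ?case using subgroup.one_closed[OF G] by (simp add: pgl_class_one)
next
  case (Suc n)
  then show ?case
    using subgroup.m_closed[OF G A(2) Suc] by (simp add: pgl_class_mult A mpow_invertible)
qed

lemma diag_in_power:
  assumes "subgroup G PGL3" "diag_in G a b c" shows "diag_in G (a ^ n) (b ^ n) (c ^ n)"
proof -
  obtain A P where AP: "invertible A" "pgl_class A \<in> G" "invertible P" "A ** P = P ** diag3 a b c"
    using assms(2) unfolding diag_in_def by blast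
  have "mpow A n ** P = P ** diag3 (a ^ n) (b ^ n) (c ^ n)"
    using mpow_conj[OF AP(4)] by (simp add: mpow_diag3)
  then show ?thesis
    using pgl_class_mpow_in[OF assms(1) AP(1,2)] mpow_invertible[OF AP(1)] AP(3)
    unfolding diag_in_def by blast
qed

lemma diag_in_exponents:
  assumes G: "subgroup G PGL3" and z: "primitive_root_of_unity n z"
    and d: "diag_in G (z ^ a) (z ^ b) (z ^ c)"
  shows "diag_in G (z ^ ((m * a + t) mod n)) (z ^ ((m * b + t) mod n)) (z ^ ((m * c + t) mod n))"
proof -
  have zn: "z ^ n = 1" and z0: "z \<noteq> 0"
    using z by (auto simp: primitive_root_of_unity_def power_0_left)
  have "z ^ (k mod n) = z ^ k" for k
    using zn by (metis mod_mult_div_eq power_add power_mult power_one mult.right_neutral add.commute)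
  then have "z ^ ((m * k + t) mod n) = z ^ t * (z ^ k) ^ m" for k
    by (simp add: power_add power_mult mult.commute)
  then show ?thesis using diag_in_scale[OF diag_in_power[OF G d, of m], of "z ^ t"] z0 by simp
qed

lemma diag_class_in_conjugate:
  assumes G: "subgroup G PGL3" and A: "invertible A" "pgl_class A \<in> G"
    and P: "invertible P" and AP: "A ** P = P ** D"
  shows "pgl_class D \<in> (pgl_class (matrix_inv P) <#\<^bsub>PGL3\<^esub> G) #>\<^bsub>PGL3\<^esub> (inv\<^bsub>PGL3\<^esub> (pgl_class (matrix_inv P)))"
proof -
  have Q: "invertible (matrix_inv P)" by (rule invertible_matrix_inv[OF P])
  have "D = matrix_inv P ** A ** P"
    by (metis AP matrix_inv_cancel(2)[OF P] matrix_mul_assoc)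
  moreover have "pgl_class P = inv\<^bsub>PGL3\<^esub> (pgl_class (matrix_inv P))"
    by (metis P pgl_class_in_carrier pgl_class_inv group.inv_inv[OF group_PGL3])
  ultimately have "pgl_class D = pgl_class (matrix_inv P) \<otimes>\<^bsub>PGL3\<^esub> pgl_class A
      \<otimes>\<^bsub>PGL3\<^esub> inv\<^bsub>PGL3\<^esub> (pgl_class (matrix_inv P))"
    using A P Q by (metis pgl_class_mult invertible_mult)
  then show ?thesis using A(2) unfolding r_coset_def l_coset_def by blast
qed

lemma diag_in_conjugate:
  assumes G: "subgroup G PGL3" and d: "diag_in G a b c"
  shows "\<exists>\<phi>\<in>carrier PGL3. generate PGL3 {pgl_class (diag3 a b c)} \<subseteq>
    (\<phi> <#\<^bsub>PGL3\<^esub> G) #>\<^bsub>PGL3\<^esub> (inv\<^bsub>PGL3\<^esub> \<phi>)"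
proof -
  obtain A P where AP: "invertible A" "pgl_class A \<in> G" "invertible P" "A ** P = P ** diag3 a b c"
    using d unfolding diag_in_def by blast
  let ?\<phi> = "pgl_class (matrix_inv P)"
  have \<phi>: "?\<phi> \<in> carrier PGL3" by (rule pgl_class_in_carrier[OF invertible_matrix_inv[OF AP(3)]])
  show ?thesis
    by (rule bexI[OF group.generate_subgroup_incl[OF group_PGL3] \<phi>])
       (simp_all add: diag_class_in_conjugate[OF G AP]
          group.subgroup_conjugation_is_surj2[OF group_PGL3 \<phi> G])
qed

section \<open>Roots of unity\<close>

lemma roots_of_unity_powers:
  fixes z :: "'a::field"
  assumes z: "primitive_root_of_unity n z" and w: "w ^ n = 1"
  shows "\<exists>k<n. w = z ^ k"
proof -
  have n: "n > 0" and z0: "z \<noteq> 0" and zn: "z ^ n = 1"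
    using z by (auto simp: primitive_root_of_unity_def power_0_left)
  let ?p = "Polynomial.monom 1 n - 1 :: 'a poly"
  have deg: "Polynomial.degree ?p \<le> n" by (intro degree_diff_le) (auto simp: degree_monom_le)
  have "Polynomial.coeff ?p n = 1" using n by simp
  then have "?p \<noteq> 0" by (metis coeff_0 zero_neq_one)
  then have fin: "finite {x. x ^ n = (1::'a)}" and card: "card {x. x ^ n = (1::'a)} \<le> n"
    using poly_roots_finite[of ?p] card_poly_roots_bound[of ?p] deg by (auto simp: poly_monom)
  have inj: "inj_on (\<lambda>k. z ^ k) {..<n}"
  proof (rule linorder_inj_onI')
    fix j k assume "j \<in> {..<n}" "k \<in> {..<n}" "j < k"
    then have "z ^ (k - j) \<noteq> 1" using z by (auto simp: primitive_root_of_unity_def)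
    moreover have "z ^ k = z ^ j * z ^ (k - j)" using \<open>j < k\<close> by (simp add: power_add[symmetric])
    ultimately show "z ^ j \<noteq> z ^ k" using z0 by auto
  qed
  have "(\<lambda>k. z ^ k) ` {..<n} \<subseteq> {x. x ^ n = 1}"
  proof -
    have "(z ^ k) ^ n = (z ^ n) ^ k" for k by (simp add: mult.commute flip: power_mult)
    then show ?thesis using zn by auto
  qed
  moreover have "card ((\<lambda>k. z ^ k) ` {..<n}) = n" using inj by (simp add: card_image)
  ultimately have "(\<lambda>k. z ^ k) ` {..<n} = {x. x ^ n = 1}"
    using fin card by (intro card_seteq) auto
  then show ?thesis using w by blast
qed

lemma primitive_root_of_unity_primeI:
  fixes z :: "'a::field"
  assumes "prime p" "z ^ p = 1" "z \<noteq> 1"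
  shows "primitive_root_of_unity p z"
  unfolding primitive_root_of_unity_def
proof (intro conjI allI impI)
  fix m assume "0 < m \<and> m < p"
  then show "z ^ m \<noteq> 1"
    using dvd_of_power_int_eq_1[OF assms, of "int m"] by (auto dest: nat_dvd_not_less)
qed (use assms prime_gt_0_nat in auto)

text \<open>A root of \<open>1 + X + \<dots> + X\<^bsup>p-1\<^esup>\<close> differs from 1, as \<open>p \<noteq> 0\<close> in \<open>K\<close>.\<close>

lemma exists_primitive_root_prime:
  assumes p: "prime (p::nat)"
  obtains z :: "'a::{alg_closed_field, field_char_0}" where "primitive_root_of_unity p z"
proof -
  have "\<exists>z::'a. (\<Sum>k\<le>p - 1. 1 * z ^ k) = 0"
    by (rule alg_closed) (use prime_gt_1_nat[OF p] in auto)
  then obtain z :: 'a where "(\<Sum>k\<le>p - 1. z ^ k) = 0" by auto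
  moreover have "{..p - 1} = {..<p}" using prime_gt_0_nat[OF p] by auto
  ultimately have z: "(\<Sum>k<p. z ^ k) = 0" by simp
  have "z \<noteq> 1" using z prime_gt_0_nat[OF p] by auto
  moreover have "z ^ p - 1 = (z - 1) * (\<Sum>k<p. z ^ k)" by (rule power_diff_1_eq)
  then have "z ^ p = 1" by (simp add: z)
  ultimately show ?thesis using that primitive_root_of_unity_primeI[OF p] by blast
qed

section \<open>Elements whose square is not the identity\<close>

lemma diag_in_equivariant:
  assumes F: "regular_triple F" and GF: "\<And>A. invertible A \<Longrightarrow> pgl_class A \<in> G \<Longrightarrow> equivariant F A"
    and d: "diag_in G a b c"
  obtains E where "regular_triple E" "equivariant E (diag3 a b c)"
proof -
  obtain A P where AP: "invertible A" "pgl_class A \<in> G" "invertible P" "A ** P = P ** diag3 a b c"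
    using d unfolding diag_in_def by blast
  show ?thesis
    using that[of "conj_triple P F"] regular_conj_triple[OF F AP(3)]
      equivariant_conj_triple[OF AP(3,4)] GF[OF AP(1,2)] by blast
qed

text \<open>An equal pair of eigenvalues would make the matrix a homology, so its square would be scalar by
  \<open>equivariant_homology_square\<close>, against \<open>g\<^sup>2 \<noteq> 1\<close>.\<close>

lemma distinct_eigenvalues:
  fixes G :: "('a::{alg_closed_field, field_char_0}^3^3) set set" and z :: 'a
  assumes G: "subgroup G PGL3"
    and F: "regular_triple F" and GF: "\<And>A. invertible A \<Longrightarrow> pgl_class A \<in> G \<Longrightarrow> equivariant F A"
    and g: "g \<in> G" "g [^]\<^bsub>PGL3\<^esub> n = \<one>\<^bsub>PGL3\<^esub>" "g [^]\<^bsub>PGL3\<^esub> (2::nat) \<noteq> \<one>\<^bsub>PGL3\<^esub>"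
    and z: "primitive_root_of_unity n z"
  obtains x y where "diag_in G 1 x y" "x ^ n = 1" "y ^ n = 1" "x \<noteq> 1" "y \<noteq> 1" "x \<noteq> y"
proof -
  have n: "n > 0" using z by (auto simp: primitive_root_of_unity_def)
  have "g \<in> carrier PGL3" using g(1) subgroup.subset[OF G] by blast
  then obtain A where A: "invertible A" "g = pgl_class A" "mpow A n = mat 1"
    using pgl_element_lift[OF _ g(2) n] by blast
  obtain P :: "'a^3^3" where P: "invertible P" "\<And>j. \<exists>r. A *v column j P = r *s column j P"
    using eigenbasis_matrix[OF span_eigenvectors_finite_order[OF z A(3)]] by blast
  then obtain r where "\<And>j. A *v column j P = r j *s column j P" by metis
  then have AP: "A ** P = P ** diag3 (r 1) (r 2) (r 3)" by (rule columns_eigenvectors)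
  have "P ** mpow (diag3 (r 1) (r 2) (r 3)) n = P ** mat 1"
    using mpow_conj[OF AP, of n] by (simp add: A(3))
  then have "mpow (diag3 (r 1) (r 2) (r 3)) n = mat 1" using matrix_inv_cancel(2)[OF P(1)] by metis
  then have rn: "r 1 ^ n = 1" "r 2 ^ n = 1" "r 3 ^ n = 1"
    by (simp_all add: mpow_diag3 mat_eq_diag3 diag3_eq_iff)
  then have r0: "r 1 \<noteq> 0" "r 2 \<noteq> 0" "r 3 \<noteq> 0" using n by (auto simp: power_0_left)
  have d: "diag_in G (r 1) (r 2) (r 3)" using A g(1) P(1) AP unfolding diag_in_def by blast
  have sq: "\<not> ((r 1)\<^sup>2 = (r 2)\<^sup>2 \<and> (r 2)\<^sup>2 = (r 3)\<^sup>2)"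
  proof
    assume "(r 1)\<^sup>2 = (r 2)\<^sup>2 \<and> (r 2)\<^sup>2 = (r 3)\<^sup>2"
    then have "mpow A 2 ** P = P ** mat ((r 1)\<^sup>2)"
      using mpow_conj[OF AP, of 2] by (simp add: mpow_diag3 mat_eq_diag3 del: mpow.simps)
    then have "P ** mat ((r 1)\<^sup>2) ** matrix_inv P = mpow A 2"
      by (metis P(1) matrix_inv_inverse(1) matrix_mul_assoc matrix_mul_rid)
    then have "mpow A 2 = mat ((r 1)\<^sup>2) ** mat 1"
      by (metis P(1) matrix_inv_inverse(1) matrix_mul_assoc mult_mat_eq)
    then have "pgl_class (mpow A 2) = pgl_class (mat 1)" using r0(1) pgl_class_scale[of "(r 1)\<^sup>2" "mat 1"] by simp
    then show False using g(3) by (simp add: A pgl_class_pow pgl_class_one del: mpow.simps)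
  qed
  have hom: "a\<^sup>2 = b\<^sup>2" if "diag_in G a a b" "a \<noteq> 0" "b \<noteq> 0" for a b
    using diag_in_equivariant[OF F GF that(1)] equivariant_homology_square[OF _ that(2,3)] by metis
  have ne: "r 1 \<noteq> r 2" "r 1 \<noteq> r 3" "r 2 \<noteq> r 3"
    using sq hom[of "r 1" "r 3"] hom[of "r 1" "r 2"] hom[of "r 2" "r 1"] d diag_in_permutations[OF d] r0 by metis+
  show ?thesis
  proof (rule that)
    show "diag_in G 1 (r 2 / r 1) (r 3 / r 1)"
      using diag_in_scale[OF d, of "inverse (r 1)"] r0 by (simp add: divide_inverse mult.commute)
  qed (use rn r0 ne in \<open>simp_all add: power_divide\<close>)
qed

text \<open>The affine map \<open>x \<mapsto> m x + t\<close> modulo \<open>n\<close> on exponents is the \<open>m\<close>-th power followed by scaling by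
  \<open>z\<^sup>t\<close>; that it need only match sets of exponents accounts for permutations.\<close>

lemma diag_in_affine_exponents:
  assumes G: "subgroup G PGL3" and z: "primitive_root_of_unity n z"
    and d: "diag_in G 1 (z ^ j) (z ^ k)"
    and T: "{t mod n, (m * j + t) mod n, (m * k + t) mod n} = {0, 1, e}" and e: "1 < e"
  shows "diag_in G 1 z (z ^ e)"
proof -
  define a b c where "a = t mod n" and "b = (m * j + t) mod n" and "c = (m * k + t) mod n"
  have "diag_in G (z ^ a) (z ^ b) (z ^ c)"
    using diag_in_exponents[OF G z, of 0 j k m t] d by (simp add: a_def b_def c_def)
  note perms = this diag_in_permutations[OF this]
  have abc: "{a, b, c} = {0, 1, e}" using T by (simp add: a_def b_def c_def)
  have vals: "0 \<in> {a, b, c}" "1 \<in> {a, b, c}" "e \<in> {a, b, c}" unfolding abc by blast+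
  have "a \<in> {0, 1, e}" "b \<in> {0, 1, e}" "c \<in> {0, 1, e}" using abc by blast+
  then have "(a, b, c) \<in> {(0, 1, e), (0, e, 1), (1, 0, e), (1, e, 0), (e, 0, 1), (e, 1, 0)}"
    by (elim insertE emptyE) (use vals e in simp_all)
  then show ?thesis using perms by auto
qed

text \<open>If the order \<open>N\<close> of \<open>g\<close> does not divide 2, it has an odd prime factor or is divisible by 4, and
  a power of \<open>g\<close> has the required order.\<close>

lemma element_of_order_four_or_odd_prime:
  fixes G :: "('a::field^3^3) set set"
  assumes G: "subgroup G PGL3" "finite G" and g: "g \<in> G" "g [^]\<^bsub>PGL3\<^esub> (2::nat) \<noteq> \<one>\<^bsub>PGL3\<^esub>"
  obtains h n where "h \<in> G" "h [^]\<^bsub>PGL3\<^esub> n = \<one>\<^bsub>PGL3\<^esub>" "h [^]\<^bsub>PGL3\<^esub> (2::nat) \<noteq> \<one>\<^bsub>PGL3\<^esub>"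
    "n = 4 \<or> prime (n::nat) \<and> odd n"
proof -
  interpret PGL3: group "PGL3 :: ('a^3^3) set monoid" by (rule group_PGL3)
  have gc: "g \<in> carrier PGL3" using g(1) subgroup.subset[OF G(1)] by blast
  interpret G: group "PGL3\<lparr>carrier := G\<rparr>" by (rule PGL3.subgroup_imp_group[OF G(1)])
  have "g [^]\<^bsub>PGL3\<lparr>carrier := G\<rparr>\<^esub> Coset.order (PGL3\<lparr>carrier := G\<rparr>) = \<one>\<^bsub>PGL3\<lparr>carrier := G\<rparr>\<^esub>"
    by (rule G.pow_order_eq_1) (use g(1) in simp)
  then have "g [^]\<^bsub>PGL3\<^esub> card G = \<one>\<^bsub>PGL3\<^esub>"
    by (simp add: Coset.order_def PGL3.nat_pow_consistent[symmetric])
  then have "PGL3.ord g dvd card G" using PGL3.pow_eq_id[OF gc] by simp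
  moreover have "card G > 0" using G(2) g(1) by (auto simp: card_gt_0_iff)
  ultimately have N: "PGL3.ord g > 0" by (auto intro: Nat.gr0I)
  define N where "N = PGL3.ord g"
  have N2: "\<not> N dvd 2" using PGL3.pow_eq_id[OF gc, of 2] g(2) by (simp add: N_def)
  have pow: "(g [^]\<^bsub>PGL3\<^esub> k) [^]\<^bsub>PGL3\<^esub> j = \<one>\<^bsub>PGL3\<^esub> \<longleftrightarrow> N dvd k * j" for j k :: nat
    by (simp add: PGL3.nat_pow_pow[OF gc] PGL3.pow_eq_id[OF gc] N_def)
  have in_G: "g [^]\<^bsub>PGL3\<^esub> (k::nat) \<in> G" for k
    using G.nat_pow_closed[of g k] g(1) by (simp add: PGL3.nat_pow_consistent[symmetric])
  have "4 dvd N \<or> (\<exists>p. prime p \<and> odd p \<and> p dvd N)"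
  proof (cases "4 dvd N")
    case False
    define M where "M = (if odd N then N else N div 2)"
    have "odd M" "M dvd N" using False by (auto simp: M_def elim!: evenE)
    moreover have "M \<noteq> 1" using N2 by (auto simp: M_def elim!: evenE split: if_splits)
    ultimately show ?thesis by (metis dvd_trans prime_factor_nat)
  qed simp
  then show ?thesis
  proof
    assume "4 dvd N"
    then obtain k where k: "N = 4 * k" by blast
    then have "k > 0" using N by (simp add: N_def)
    show ?thesis
      by (rule that[OF in_G[of k], of 4]) (use k \<open>k > 0\<close> in \<open>auto simp: pow dest: dvd_imp_le\<close>)
  next
    assume "\<exists>p. prime p \<and> odd p \<and> p dvd N"
    then obtain p k where p: "prime p" "odd p" "N = p * k" by blast
    then have "k > 0" using N by (auto simp: N_def)
    have "p > 2" using p(1,2) by (metis prime_ge_2_nat le_neq_implies_less even_numeral)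
    show ?thesis
      by (rule that[OF in_G[of k], of p]) (use p \<open>k > 0\<close> \<open>p > 2\<close> in \<open>auto simp: pow mult.commute dest: dvd_imp_le\<close>)
  qed
qed

text \<open>The multipliers \<open>m\<close> and shifts \<open>t\<close> in the proof are the affine maps that bring the exponents to
  normal form.  For \<open>n = 5\<close> all triples of distinct exponents are affinely equivalent; for \<open>n = 7\<close> the relation
  of \<open>equivariant_large_prime\<close> singles out \<open>{0, 1, 5}\<close>, which is equivalent to \<open>{0, 1, 3}\<close>.\<close>

lemma diag_in_of_element:
  fixes G :: "('a::{alg_closed_field, field_char_0}^3^3) set set" and n :: nat
  assumes G: "subgroup G PGL3"
    and F: "regular_triple F" and GF: "\<And>A. invertible A \<Longrightarrow> pgl_class A \<in> G \<Longrightarrow> equivariant F A"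
    and n: "n = 4 \<or> prime n \<and> odd n"
    and z3: "primitive_root_of_unity 3 z3" and z4: "primitive_root_of_unity 4 z4"
    and z5: "primitive_root_of_unity 5 z5" and z7: "primitive_root_of_unity 7 z7"
    and h: "h \<in> G" "h [^]\<^bsub>PGL3\<^esub> n = \<one>\<^bsub>PGL3\<^esub>" "h [^]\<^bsub>PGL3\<^esub> (2::nat) \<noteq> \<one>\<^bsub>PGL3\<^esub>"
  shows "diag_in G 1 z3 (z3 ^ 2) \<or> diag_in G 1 z4 (z4 ^ 2) \<or> diag_in G 1 z5 (z5 ^ 3) \<or> diag_in G 1 z7 (z7 ^ 3)"
proof -
  have exps: "\<exists>j k. j < n \<and> k < n \<and> j \<noteq> 0 \<and> k \<noteq> 0 \<and> j \<noteq> k \<and> diag_in G 1 (z ^ j) (z ^ k)"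
    if z: "primitive_root_of_unity n z" for z
  proof -
    obtain x y where xy: "diag_in G 1 x y" "x ^ n = 1" "y ^ n = 1" "x \<noteq> 1" "y \<noteq> 1" "x \<noteq> y"
      by (rule distinct_eigenvalues[OF G F GF h z])
    obtain j k where "j < n" "x = z ^ j" "k < n" "y = z ^ k"
      using roots_of_unity_powers[OF z xy(2)] roots_of_unity_powers[OF z xy(3)] by blast
    then show ?thesis using xy by (intro exI[of _ j] exI[of _ k]) (auto intro!: Nat.gr0I)
  qed
  consider "n = 3" | "n = 4" | "n = 5" | "prime n" "n \<ge> 7"
  proof -
    have "n \<noteq> 0" "n \<noteq> 1" "n \<noteq> 2" "n \<noteq> 6" using n by (auto simp: prime_nat_iff)
    then show ?thesis using n that by force
  qed
  then show ?thesis
  proof cases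
    case 1
    obtain j k where jk: "j < 3" "k < 3" "j \<noteq> 0" "k \<noteq> 0" "j \<noteq> k" "diag_in G 1 (z3 ^ j) (z3 ^ k)"
      using exps z3 unfolding 1 by blast
    have "j = 1 \<and> k = 2 \<or> j = 2 \<and> k = 1" using jk by auto
    then have "\<exists>m t. {t mod 3, (m * j + t) mod 3, (m * k + t) mod 3} = {0, 1, 2}"
      by (elim disjE conjE; intro exI[of _ 1] exI[of _ 0]) auto
    then show ?thesis using diag_in_affine_exponents[OF G z3 jk(6)] by force
  next
    case 2
    obtain j k where jk: "j < 4" "k < 4" "j \<noteq> 0" "k \<noteq> 0" "j \<noteq> k" "diag_in G 1 (z4 ^ j) (z4 ^ k)"
      using exps z4 unfolding 2 by blast
    have "\<exists>m t. {t mod 4, (m * j + t) mod 4, (m * k + t) mod 4} = {0, 1, 2}"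
    proof -
      have "j \<in> {1, 2, 3}" "k \<in> {1, 2, 3}" using jk(1-4) by auto
      then consider "j = 1 \<and> k = 2 \<or> j = 2 \<and> k = 1" | "j = 1 \<and> k = 3 \<or> j = 3 \<and> k = 1"
        | "j = 2 \<and> k = 3 \<or> j = 3 \<and> k = 2" using jk(5) by auto
      then show ?thesis
      proof cases
        case 1 then show ?thesis by (intro exI[of _ 1] exI[of _ 0]) auto
      next
        case 2 then show ?thesis by (intro exI[of _ 1] exI[of _ 1]) auto
      next
        case 3 then show ?thesis by (intro exI[of _ 1] exI[of _ 2]) auto
      qed
    qed
    then show ?thesis using diag_in_affine_exponents[OF G z4 jk(6)] by force
  next
    case 3
    obtain j k where jk: "j < 5" "k < 5" "j \<noteq> 0" "k \<noteq> 0" "j \<noteq> k" "diag_in G 1 (z5 ^ j) (z5 ^ k)"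
      using exps z5 unfolding 3 by blast
    have "\<exists>m t. {t mod 5, (m * j + t) mod 5, (m * k + t) mod 5} = {0, 1, 3}"
    proof -
      have "j \<in> {1, 2, 3, 4}" "k \<in> {1, 2, 3, 4}" using jk(1-4) by auto
      then consider "j = 1 \<and> k = 2 \<or> j = 2 \<and> k = 1" | "j = 1 \<and> k = 3 \<or> j = 3 \<and> k = 1"
        | "j = 1 \<and> k = 4 \<or> j = 4 \<and> k = 1" | "j = 2 \<and> k = 3 \<or> j = 3 \<and> k = 2"
        | "j = 2 \<and> k = 4 \<or> j = 4 \<and> k = 2" | "j = 3 \<and> k = 4 \<or> j = 4 \<and> k = 3"
        using jk(5) by auto
      then show ?thesis
      proof cases
        case 1 then show ?thesis by (intro exI[of _ 3] exI[of _ 0]) auto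
      next
        case 2 then show ?thesis by (intro exI[of _ 1] exI[of _ 0]) auto
      next
        case 3 then show ?thesis by (intro exI[of _ 2] exI[of _ 3]) auto
      next
        case 4 then show ?thesis by (intro exI[of _ 1] exI[of _ 3]) auto
      next
        case 5 then show ?thesis by (intro exI[of _ 4] exI[of _ 0]) auto
      next
        case 6 then show ?thesis by (intro exI[of _ 2] exI[of _ 0]) auto
      qed
    qed
    then show ?thesis using diag_in_affine_exponents[OF G z5 jk(6)] by force
  next
    case 4
    obtain z :: 'a where z: "primitive_root_of_unity n z"
      using exists_primitive_root_prime[OF 4(1)] by blast
    obtain x y where xy: "diag_in G 1 x y" "x ^ n = 1" "y ^ n = 1" "x \<noteq> 1"
      by (rule distinct_eigenvalues[OF G F GF h z])
    obtain E where E: "regular_triple E" "equivariant E (diag3 1 x y)"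
      by (rule diag_in_equivariant[OF F GF xy(1)])
    have n7: "n = 7" and rel: "y = x ^ 5 \<or> x = y ^ 5"
      using equivariant_large_prime[OF E(1) 4 xy(2-4) E(2)] by auto
    have "\<exists>w. w ^ 7 = 1 \<and> w \<noteq> 1 \<and> diag_in G 1 w (w ^ 5)"
      using rel
    proof
      assume "y = x ^ 5"
      then show ?thesis using xy n7 by blast
    next
      assume "x = y ^ 5"
      then show ?thesis
        using xy n7 diag_in_swap23[OF xy(1)] by (intro exI[of _ y]) auto
    qed
    then obtain w where w: "w ^ 7 = 1" "w \<noteq> 1" "diag_in G 1 w (w ^ 5)" by blast
    obtain j where j: "j < 7" "w = z7 ^ j" using roots_of_unity_powers[OF z7 w(1)] by blast
    have "\<exists>m t. {t mod 7, (m * j + t) mod 7, (m * (j * 5) + t) mod 7} = {0, 1, 3}"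
    proof -
      have "j \<noteq> 0" using j(2) w(2) by (metis power_0)
      then consider "j = 1" | "j = 2" | "j = 3" | "j = 4" | "j = 5" | "j = 6" using j(1) by linarith
      then show ?thesis
      proof cases
        case 1 then show ?thesis by (intro exI[of _ 3] exI[of _ 0]) auto
      next
        case 2 then show ?thesis by (intro exI[of _ 5] exI[of _ 0]) auto
      next
        case 3 then show ?thesis by (intro exI[of _ 1] exI[of _ 0]) auto
      next
        case 4 then show ?thesis by (intro exI[of _ 6] exI[of _ 0]) auto
      next
        case 5 then show ?thesis by (intro exI[of _ 2] exI[of _ 0]) auto
      next
        case 6 then show ?thesis by (intro exI[of _ 4] exI[of _ 0]) auto
      qed
    qed
    moreover have "diag_in G 1 (z7 ^ j) (z7 ^ (j * 5))" using w(3) by (simp add: j(2) power_mult)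
    ultimately show ?thesis using diag_in_affine_exponents[OF G z7] by force
  qed
qed

section \<open>Groups of exponent two\<close>

text \<open>A scalar commutator \<open>c\<close> of two involutions satisfies \<open>c\<^sup>2 = 1\<close>, and \<open>c\<^sup>3 = 1\<close> by determinants.
  Thus commuting classes in PGL(3,K) lift to commuting matrices.\<close>

lemma involutions_commute:
  fixes A B :: "'a::field^3^3"
  assumes A: "A ** A = mat 1" and B: "B ** B = mat 1" and AB: "A ** B = mat c ** (B ** A)"
  shows "A ** B = B ** A"
proof -
  have "mat c ** (A ** B) = A ** (mat c ** (B ** A)) ** A"
    by (metis A matrix_mul_assoc matrix_mul_rid mult_mat_eq)
  also have "\<dots> = B ** A"
    unfolding AB[symmetric] by (metis A matrix_mul_assoc matrix_mul_lid)
  finally have "mat c ** (mat c ** (B ** A)) = B ** A" by (simp only: AB)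
  then have "mat (c * c) ** (B ** A) ** (A ** B) = B ** A ** (A ** B)"
    by (simp add: matrix_mul_assoc mat_mult_mat)
  moreover have BAAB: "B ** A ** (A ** B) = mat 1" by (metis A B matrix_mul_assoc matrix_mul_lid)
  ultimately have "mat (c * c) = (mat 1 :: 'a^3^3)"
    by (metis matrix_mul_assoc matrix_mul_rid)
  then have c2: "c * c = 1" by (simp add: mat_eq_diag3 diag3_eq_iff)
  have "det (A ** B) = c ^ 3 * det (B ** A)"
    by (simp only: AB det_mul) (simp add: mat_eq_diag3 det_3 diag3_def power3_eq_cube)
  moreover have "det A * det A = 1" "det B * det B = 1"
    using A B by (metis det_mul det_I)+
  then have "det (B ** A) \<noteq> 0" by (auto simp: det_mul)
  ultimately have "c ^ 3 = 1" by (simp add: det_mul mult.commute)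
  then have "c = 1" using c2 by (simp add: power3_eq_cube)
  then show ?thesis using AB by simp
qed

lemma klein_four_of_exponent_two:
  fixes G :: "('a::{alg_closed_field, field_char_0}^3^3) set set"
  assumes G: "subgroup G PGL3" "card G \<ge> 3"
    and exp2: "\<And>g. g \<in> G \<Longrightarrow> g [^]\<^bsub>PGL3\<^esub> (2::nat) = \<one>\<^bsub>PGL3\<^esub>"
  shows "\<exists>\<phi>\<in>carrier PGL3.
    generate PGL3 {pgl_class (diag3 1 (- 1) 1), pgl_class (diag3 1 1 (- 1))} \<subseteq>
    (\<phi> <#\<^bsub>PGL3\<^esub> G) #>\<^bsub>PGL3\<^esub> (inv\<^bsub>PGL3\<^esub> \<phi>)"
proof -
  interpret PGL3: group "PGL3 :: ('a^3^3) set monoid" by (rule group_PGL3)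
  have GC: "G \<subseteq> carrier PGL3" by (rule subgroup.subset[OF G(1)])
  have "\<exists>a b. a \<in> G \<and> b \<in> G \<and> a \<noteq> \<one>\<^bsub>PGL3\<^esub> \<and> b \<noteq> \<one>\<^bsub>PGL3\<^esub> \<and> a \<noteq> b"
  proof (rule ccontr)
    assume no: "\<not> ?thesis"
    obtain a where "G \<subseteq> {\<one>\<^bsub>PGL3\<^esub>, a}"
    proof (cases "G \<subseteq> {\<one>\<^bsub>PGL3\<^esub>}")
      case False
      then obtain a where "a \<in> G" "a \<noteq> \<one>\<^bsub>PGL3\<^esub>" by blast
      then show ?thesis using no that by blast
    qed (use that in blast)
    then have "card G \<le> card {\<one>\<^bsub>PGL3\<^esub>, a}" by (intro card_mono) auto
    also have "\<dots> \<le> 2" by (simp add: card_insert_if)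
    finally show False using G(2) by simp
  qed
  then obtain a b where ab: "a \<in> G" "b \<in> G" "a \<noteq> \<one>\<^bsub>PGL3\<^esub>" "b \<noteq> \<one>\<^bsub>PGL3\<^esub>" "a \<noteq> b" by blast
  obtain A where A: "invertible A" "a = pgl_class A" "mpow A 2 = mat 1"
    using pgl_element_lift[OF _ exp2[OF ab(1)]] ab(1) GC by auto
  obtain B where B: "invertible B" "b = pgl_class B" "mpow B 2 = mat 1"
    using pgl_element_lift[OF _ exp2[OF ab(2)]] ab(2) GC by auto
  have AA: "A ** A = mat 1" and BB: "B ** B = mat 1"
    using A(3) B(3) by (simp_all add: numeral_2_eq_2)
  have "pgl_class (A ** B) = pgl_class (B ** A)"
  proof -
    have inv: "inv\<^bsub>PGL3\<^esub> g = g" if "g \<in> G" for g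
      using exp2[OF that] that GC by (intro PGL3.inv_equality) (auto simp: numeral_2_eq_2)
    have "a \<otimes>\<^bsub>PGL3\<^esub> b = inv\<^bsub>PGL3\<^esub> (a \<otimes>\<^bsub>PGL3\<^esub> b)"
      using inv subgroup.m_closed[OF G(1) ab(1,2)] by simp
    also have "\<dots> = b \<otimes>\<^bsub>PGL3\<^esub> a"
      using ab GC inv by (subst PGL3.inv_mult_group) auto
    finally show ?thesis using A B by (simp add: pgl_class_mult)
  qed
  then obtain c where "A ** B = mat c ** (B ** A)" by (rule pgl_class_eqD)
  then have AB: "A ** B = B ** A" by (rule involutions_commute[OF AA BB])
  obtain P :: "'a^3^3" where P: "invertible P"
    "\<And>j. \<exists>r s. A *v column j P = r *s column j P \<and> B *v column j P = s *s column j P"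
    using eigenbasis_matrix[OF span_common_eigenvectors_involutions[OF AA BB AB]] by blast
  then obtain r s where rs: "\<And>j. A *v column j P = r j *s column j P" "\<And>j. B *v column j P = s j *s column j P"
    by metis
  have AP: "A ** P = P ** diag3 (r 1) (r 2) (r 3)" and BP: "B ** P = P ** diag3 (s 1) (s 2) (s 3)"
    by (rule columns_eigenvectors, rule rs)+
  have sgn: "x = 1 \<or> x = - 1" if "x ^ 2 = 1" for x :: 'a using that by (simp add: power2_eq_1_iff)
  have diag_sq: "d1\<^sup>2 = 1 \<and> d2\<^sup>2 = 1 \<and> d3\<^sup>2 = 1"
    if "C ** P = P ** diag3 d1 d2 d3" "C ** C = mat 1" for C d1 d2 d3
  proof -
    have "P ** mpow (diag3 d1 d2 d3) 2 = P ** mat 1"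
      using mpow_conj[OF that(1), of 2] that(2) by (simp add: numeral_2_eq_2)
    then have "mpow (diag3 d1 d2 d3) 2 = mat 1" using matrix_inv_cancel(2)[OF P(1)] by metis
    then show ?thesis by (simp add: mpow_diag3 mat_eq_diag3 diag3_eq_iff del: mpow.simps)
  qed
  \<comment> \<open>In the fixed eigenbasis \<open>P\<close>, the group contains the diagonal class with entries \<open>1, x, y\<close>.\<close>
  define T where "T x y \<longleftrightarrow> (\<exists>C. invertible C \<and> pgl_class C \<in> G \<and> C ** P = P ** diag3 1 x y)" for x y
  have T_mult: "T (x * x') (y * y')" if T: "T x y" "T x' y'" for x y x' y'
  proof -
    obtain C C' where C: "invertible C" "pgl_class C \<in> G" "C ** P = P ** diag3 1 x y"
      "invertible C'" "pgl_class C' \<in> G" "C' ** P = P ** diag3 1 x' y'"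
      using T unfolding T_def by blast
    have "(C ** C') ** P = (C ** P) ** diag3 1 x' y'" by (simp add: C(6) matrix_mul_assoc[symmetric])
    also have "\<dots> = P ** diag3 1 (x * x') (y * y')"
      by (simp add: C(3) matrix_mul_assoc[symmetric] diag3_mult)
    finally have "(C ** C') ** P = P ** diag3 1 (x * x') (y * y')" .
    moreover have "pgl_class (C ** C') \<in> G"
      using subgroup.m_closed[OF G(1) C(2,5)] C(1,4) by (simp add: pgl_class_mult)
    ultimately show ?thesis using C(1,4) invertible_mult unfolding T_def by blast
  qed
  \<comment> \<open>The eigenvalues are signs, so scaling by the first one makes it 1.\<close>
  have normalized: "\<exists>x y. (x = 1 \<or> x = - 1) \<and> (y = 1 \<or> y = - 1) \<and>
      (\<exists>C'. invertible C' \<and> pgl_class C' = pgl_class C \<and> C' ** P = P ** diag3 1 x y)"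
    if C: "invertible C" "C ** P = P ** diag3 d1 d2 d3" "C ** C = mat 1" for C d1 d2 d3
  proof -
    have sq: "d1 = 1 \<or> d1 = -1" "d2 = 1 \<or> d2 = -1" "d3 = 1 \<or> d3 = -1"
      using diag_sq[OF C(2,3)] sgn by blast+
    then have d1: "d1 \<noteq> 0" "d1 * d1 = 1" by auto
    have "(mat d1 ** C) ** P = mat d1 ** (P ** diag3 d1 d2 d3)" by (simp add: C(2) matrix_mul_assoc[symmetric])
    also have "\<dots> = P ** (mat d1 ** diag3 d1 d2 d3)" by (metis matrix_mul_assoc mult_mat_eq)
    also have "mat d1 ** diag3 d1 d2 d3 = diag3 1 (d1 * d2) (d1 * d3)"
      by (simp add: mat_eq_diag3 diag3_mult d1(2))
    finally have "(mat d1 ** C) ** P = P ** diag3 1 (d1 * d2) (d1 * d3)" .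
    moreover have "invertible (mat d1 ** C)" "pgl_class (mat d1 ** C) = pgl_class C"
      using C(1) d1(1) by (simp_all add: invertible_mult invertible_mat pgl_class_scale)
    moreover have "(d1 * d2 = 1 \<or> d1 * d2 = -1) \<and> (d1 * d3 = 1 \<or> d1 * d3 = -1)" using sq by auto
    ultimately show ?thesis by blast
  qed
  obtain x y A' where x: "x = 1 \<or> x = - 1" "y = 1 \<or> y = - 1"
    and A': "invertible A'" "pgl_class A' = a" "A' ** P = P ** diag3 1 x y"
    using normalized[OF A(1) AP AA] A(2) by blast
  obtain u v B' where u: "u = 1 \<or> u = - 1" "v = 1 \<or> v = - 1"
    and B': "invertible B'" "pgl_class B' = b" "B' ** P = P ** diag3 1 u v"
    using normalized[OF B(1) BP BB] B(2) by blast
  have cancel: "C = D" if "C ** P = P ** X" "D ** P = P ** X" for C D X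
    using that by (metis P(1) matrix_inv_inverse(1) matrix_mul_assoc matrix_mul_rid)
  have "mat 1 ** P = P ** diag3 1 1 1" by (simp add: mat_eq_diag3[symmetric])
  then have nontriv: "(x, y) \<noteq> (1, 1)" "(u, v) \<noteq> (1, 1)"
    using cancel A' B' ab(3,4) pgl_class_one by (metis prod.inject)+
  have "(x, y) \<noteq> (u, v)" using cancel A' B' ab(5) by (metis prod.inject)
  moreover have TA: "T x y" and TB: "T u v" using A' B' ab(1,2) unfolding T_def by blast+
  moreover note T_mult[OF TA TB]
  \<comment> \<open>Two distinct nontrivial sign vectors and their product exhaust the three nontrivial ones.\<close>
  ultimately have T: "T (- 1) 1" "T 1 (- 1)" using nontriv x u by auto
  let ?\<phi> = "pgl_class (matrix_inv P)"
  have \<phi>: "?\<phi> \<in> carrier PGL3" by (rule pgl_class_in_carrier[OF invertible_matrix_inv[OF P(1)]])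
  have mem: "pgl_class (diag3 1 x y) \<in> (?\<phi> <#\<^bsub>PGL3\<^esub> G) #>\<^bsub>PGL3\<^esub> (inv\<^bsub>PGL3\<^esub> ?\<phi>)"
    if "T x y" for x y
    using that diag_class_in_conjugate[OF G(1) _ _ P(1)] unfolding T_def by blast
  show ?thesis
    by (rule bexI[OF PGL3.generate_subgroup_incl \<phi>])
       (simp_all add: mem T PGL3.subgroup_conjugation_is_surj2[OF \<phi> G(1)])
qed

section \<open>The classification\<close>

theorem theorem2:
  fixes G :: "('a::{alg_closed_field, field_char_0} ^ 3 ^ 3) set set"
    and \<zeta>3 i \<zeta>5 \<zeta>7 :: 'a
  assumes "subgroup G PGL3" and "finite G" and "card G \<ge> 3"
    and "primitive_root_of_unity 3 \<zeta>3" and "primitive_root_of_unity 4 i"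
    and "primitive_root_of_unity 5 \<zeta>5" and "primitive_root_of_unity 7 \<zeta>7"
    and "\<exists>f\<in>Rat22_ss G. dominant f \<and> has_rat_degree f 2 \<and> finite (rat_Aut f)"
  shows "\<exists>\<phi>\<in>carrier PGL3. \<exists>H\<in>{
       generate PGL3 {pgl_class (diag3 1 \<zeta>3 (\<zeta>3 ^ 2))},
       generate PGL3 {pgl_class (diag3 1 i (- 1))},
       generate PGL3 {pgl_class (diag3 1 \<zeta>5 (\<zeta>5 ^ 3))},
       generate PGL3 {pgl_class (diag3 1 \<zeta>7 (\<zeta>7 ^ 3))},
       generate PGL3 {pgl_class (diag3 1 (- 1) 1), pgl_class (diag3 1 1 (- 1))}}.
     H \<subseteq> (\<phi> <#\<^bsub>PGL3\<^esub> G) #>\<^bsub>PGL3\<^esub> (inv\<^bsub>PGL3\<^esub> \<phi>)"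
proof (cases "\<forall>g\<in>G. g [^]\<^bsub>PGL3\<^esub> (2::nat) = \<one>\<^bsub>PGL3\<^esub>")
  case True
  then show ?thesis using klein_four_of_exponent_two[OF assms(1,3)] by blast
next
  case False
  then obtain g where "g \<in> G" "g [^]\<^bsub>PGL3\<^esub> (2::nat) \<noteq> \<one>\<^bsub>PGL3\<^esub>" by blast
  then obtain h n where h: "h \<in> G" "h [^]\<^bsub>PGL3\<^esub> n = \<one>\<^bsub>PGL3\<^esub>" "h [^]\<^bsub>PGL3\<^esub> (2::nat) \<noteq> \<one>\<^bsub>PGL3\<^esub>"
    and n: "n = (4::nat) \<or> prime n \<and> odd n"
    by (rule element_of_order_four_or_odd_prime[OF assms(1,2)])
  obtain f where f: "f \<in> Rat22" "G \<subseteq> rat_Aut f" "dominant f" "has_rat_degree f 2" "finite (rat_Aut f)"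
    using assms(8) by (auto simp: Rat22_ss_def Rat22_of_def)
  obtain F where F: "F \<in> quadratic_triples" "f = rat_class F" "regular_triple F"
    by (rule regular_lift[OF f(1,3-5)])
  have GF: "equivariant F A" if "invertible A" "pgl_class A \<in> G" for A
    using rat_Aut_iff_equivariant[OF F(1) that(1)] that(2) f(2) F(2) by blast
  have "(i\<^sup>2)\<^sup>2 = 1" "i\<^sup>2 \<noteq> 1"
    using assms(5) by (auto simp: primitive_root_of_unity_def simp flip: power_mult)
  then have i2: "i\<^sup>2 = - 1" using power2_eq_1_iff by blast
  have conclude: "\<exists>\<phi>\<in>carrier PGL3. \<exists>H\<in>Hs. H \<subseteq> (\<phi> <#\<^bsub>PGL3\<^esub> G) #>\<^bsub>PGL3\<^esub> (inv\<^bsub>PGL3\<^esub> \<phi>)"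
    if "diag_in G a b c" "generate PGL3 {pgl_class (diag3 a b c)} \<in> Hs" for a b c Hs
    using diag_in_conjugate[OF assms(1) that(1)] that(2) by blast
  have "diag_in G 1 \<zeta>3 (\<zeta>3 ^ 2) \<or> diag_in G 1 i (i ^ 2) \<or> diag_in G 1 \<zeta>5 (\<zeta>5 ^ 3) \<or> diag_in G 1 \<zeta>7 (\<zeta>7 ^ 3)"
    by (rule diag_in_of_element[OF assms(1) F(3) GF n assms(4-7) h])
  then show ?thesis unfolding i2 by (elim disjE) (erule conclude, simp)+
qed

end
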